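(* Let $(\mu_0,\mu_1)\in\mathcal P(\mathbb R^{d_0})\times\mathcal P(\mathbb R^{d_1})$ be compactly supported, let $M>M_{\mu_0,\mu_1}$, and fix $\delta\ge0$. For $\varepsilon>0$, let $A_\varepsilon^\star\in\mathcal D_M$ be such that $\|D(\Phi_\varepsilon)_{[A_\varepsilon^\star]}\|_F\le\delta$, and let $A_0^\star$ be a cluster point of $(A_\varepsilon^\star)_{\varepsilon>0}$ (as $\varepsilon\downarrow0$). Then: 1. $\left\|64A_0^\star-32\int xy^{\intercal}d\pi_{A_0^\star}(x,y)\right\|_F\le\delta$, where $\pi_{A_0^\star}$ is a solution of $\mathrm{OT}_{A_0^\star,0}(\mu_0,\mu_1)$ (that is, this holds for some such solution). 2. If $A_\varepsilon^\star$ is a global minimizer of $\Phi_\varepsilon$ for all $\varepsilon>0$ sufficiently small, then $A_0^\star$ minimizes $\Phi_0$. 3. If, up to a subsequence $\varepsilon_n\downarrow0$ along which $A_{\varepsilon_n}^\star\to A_0^\star$, $A_{\varepsilon_n}^\star$ minimizes $\Phi_{\varepsilon_n}$ on a ball of fixed radius $r>0$ centred at $A_0^\star$, then $A_0^\star$ is a local minimizer of $\Phi_0$.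
   Context: $\Pi(\mu_0,\mu_1)$ is the set of couplings; $\mathsf D_{\mathsf{KL}}$ is the Kullback–Leibler divergence; $\|\cdot\|_F$ is the Frobenius norm; $M_2(\mu)=\int\|x\|^2d\mu(x)$; $M_{\mu_0,\mu_1}=\sqrt{M_2(\mu_0)M_2(\mu_1)}$; $\mathcal D_M=\{A\in\mathbb R^{d_0\times d_1}:\|A\|_F\le M/2\}$. For $A\in\mathbb R^{d_0\times d_1}$ and $\varepsilon\ge0$, $c_A(x,y)=-4\|x\|^2\|y\|^2-32x^{\intercal}Ay$, \[\mathrm{OT}_{A,\varepsilon}(\mu_0,\mu_1)=\inf_{\pi\in\Pi(\mu_0,\mu_1)}\int c_A\,d\pi+\varepsilon\,\mathsf D_{\mathsf{KL}}(\pi\|\mu_0\otimes\mu_1)\] (no entropy term when $\varepsilon=0$), and $\Phi_\varepsilon(A)=32\|A\|_F^2+\mathrm{OT}_{A,\varepsilon}(\mu_0,\mu_1)$. For $\varepsilon>0$, $\mathrm{OT}_{A,\varepsilon}(\mu_0,\mu_1)$ has a unique optimal coupling $\pi$, $\Phi_\varepsilon$ is differentiable, and its derivative is identified with the matrix $D(\Phi_\varepsilon)_{[A]}=64A-32\int xy^{\intercal}d\pi(x,y)$. *)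

theory Defs
  imports "HOL-Probability.Probability"
begin

text \<open>
  A matrix with \<open>d\<^sub>0\<close> rows and \<open>d\<^sub>1\<close> columns has type \<^typ>\<open>real ^ 'n ^ 'm\<close> with \<open>d\<^sub>0 = CARD('m)\<close> and
  \<open>d\<^sub>1 = CARD('n)\<close>. Its norm and inner product are those of nested vectors, i.e. the Frobenius
  norm and the Frobenius inner product.
\<close>

definition measure_support :: "'a::topological_space measure \<Rightarrow> 'a set" where
  "measure_support \<mu> = {x. \<forall>U. open U \<and> x \<in> U \<longrightarrow> emeasure \<mu> U > 0}"

definition compactly_supported_prob :: "'a::topological_space measure \<Rightarrow> bool" where
  "compactly_supported_prob \<mu> \<longleftrightarrow>
     prob_space \<mu> \<and> sets \<mu> = sets borel \<and> compact (measure_support \<mu>)"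

definition second_moment :: "'a::real_normed_vector measure \<Rightarrow> real" where
  "second_moment \<mu> = (\<integral>x. (norm x)\<^sup>2 \<partial>\<mu>)"

definition couplings :: "'a::topological_space measure \<Rightarrow> 'b::topological_space measure
    \<Rightarrow> ('a \<times> 'b) measure set" where
  "couplings \<mu>0 \<mu>1 = {\<pi>. prob_space \<pi> \<and> sets \<pi> = sets borel \<and>
     distr \<pi> borel fst = \<mu>0 \<and> distr \<pi> borel snd = \<mu>1}"

text \<open>
  The library's \<^const>\<open>KL_divergence\<close> takes the reference measure first, and is a Bochner integral, so
  it is only meaningful for an integrable log-density. For probability measures with \<open>P\<close> absolutely
  continuous with respect to \<open>Q\<close> the negative part of \<open>log (dP/dQ)\<close> is always \<open>P\<close>-integrable, hence
  failure of integrability means that the divergence is infinite.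
\<close>

definition KL :: "'a measure \<Rightarrow> 'a measure \<Rightarrow> ereal" where
  "KL P Q =
     (if absolutely_continuous Q P \<and> integrable P (entropy_density (exp 1) Q P)
      then ereal (KL_divergence (exp 1) Q P) else \<infinity>)"

definition cost :: "real ^ 'n ^ 'm \<Rightarrow> (real ^ 'm) \<times> (real ^ 'n) \<Rightarrow> real" where
  "cost A = (\<lambda>(x, y). - 4 * (norm x)\<^sup>2 * (norm y)\<^sup>2 - 32 * (x \<bullet> (A *v y)))"

definition OT_objective :: "(real ^ 'm) measure \<Rightarrow> (real ^ 'n) measure \<Rightarrow> real ^ 'n ^ 'm \<Rightarrow> real
    \<Rightarrow> ((real ^ 'm) \<times> (real ^ 'n)) measure \<Rightarrow> ereal" where
  "OT_objective \<mu>0 \<mu>1 A \<epsilon> \<pi> =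
     ereal (\<integral>z. cost A z \<partial>\<pi>) + (if \<epsilon> = 0 then 0 else ereal \<epsilon> * KL \<pi> (\<mu>0 \<Otimes>\<^sub>M \<mu>1))"

definition OT :: "(real ^ 'm) measure \<Rightarrow> (real ^ 'n) measure \<Rightarrow> real ^ 'n ^ 'm \<Rightarrow> real \<Rightarrow> ereal" where
  "OT \<mu>0 \<mu>1 A \<epsilon> = (INF \<pi>\<in>couplings \<mu>0 \<mu>1. OT_objective \<mu>0 \<mu>1 A \<epsilon> \<pi>)"

definition OT_solution :: "(real ^ 'm) measure \<Rightarrow> (real ^ 'n) measure \<Rightarrow> real ^ 'n ^ 'm \<Rightarrow> real
    \<Rightarrow> ((real ^ 'm) \<times> (real ^ 'n)) measure \<Rightarrow> bool" where
  "OT_solution \<mu>0 \<mu>1 A \<epsilon> \<pi> \<longleftrightarrow>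
     \<pi> \<in> couplings \<mu>0 \<mu>1 \<and> OT_objective \<mu>0 \<mu>1 A \<epsilon> \<pi> = OT \<mu>0 \<mu>1 A \<epsilon>"

text \<open>
  For compactly supported marginals \<^const>\<open>OT\<close> is finite: the cost is bounded on the supports, and
  the product coupling has divergence \<open>0\<close>. So no information is lost by \<^const>\<open>real_of_ereal\<close>.
\<close>

definition Phi :: "(real ^ 'm) measure \<Rightarrow> (real ^ 'n) measure \<Rightarrow> real \<Rightarrow> real ^ 'n ^ 'm \<Rightarrow> real" where
  "Phi \<mu>0 \<mu>1 \<epsilon> A = 32 * (norm A)\<^sup>2 + real_of_ereal (OT \<mu>0 \<mu>1 A \<epsilon>)"

definition outer_prod :: "real ^ 'm \<Rightarrow> real ^ 'n \<Rightarrow> real ^ 'n ^ 'm" where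
  "outer_prod x y = (\<chi> i j. x $ i * y $ j)"

definition cross_moment :: "((real ^ 'm) \<times> (real ^ 'n)) measure \<Rightarrow> real ^ 'n ^ 'm" where
  "cross_moment \<pi> = (\<integral>(x, y). outer_prod x y \<partial>\<pi>)"

definition cluster_point :: "('a \<Rightarrow> 'b::topological_space) \<Rightarrow> 'a filter \<Rightarrow> 'b \<Rightarrow> bool" where
  "cluster_point f F l \<longleftrightarrow> (\<forall>U. open U \<and> l \<in> U \<longrightarrow> (\<exists>\<^sub>F x in F. f x \<in> U))"

end

theory Submission
  imports Defs
begin

text \<open>
  A coupling that is nearly optimal for \<open>OT\<^bsub>A,\<epsilon>\<^esub>\<close> gives an upper bound for \<open>\<Phi>\<^sub>\<epsilon>\<close> that is quadratic in \<open>A\<close>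
  and almost sharp at \<open>A\<^sub>\<epsilon>\<close>. Hence its gradient there, \<open>64 A\<^sub>\<epsilon> - 32 \<integral> x y\<^sup>T d\<pi>\<close>, is close to the derivative
  of \<open>\<Phi>\<^sub>\<epsilon>\<close>, and neither existence nor uniqueness of entropic minimizers is used. The couplings are
  weakly compact, and a weak limit of such couplings along \<open>\<epsilon>\<^sub>n \<down> 0\<close> solves \<open>OT\<^bsub>A\<^sub>0,0\<^esub>\<close>, because
  \<open>OT\<^bsub>A,0\<^esub> \<le> OT\<^bsub>A,\<epsilon>\<^esub>\<close> and every coupling can be approximated by couplings of finite entropy, so that
  \<open>limsup OT\<^bsub>A\<^sub>n,\<epsilon>\<^sub>n\<^esub> \<le> OT\<^bsub>A\<^sub>0,0\<^esub>\<close>. The same two bounds give the convergence of minimizers.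

  The library has Helly's selection theorem on the line only. A space-filling curve with a Borel
  section transports measures on a ball to the line, and weak limits back.
\<close>

section \<open>A space-filling curve\<close>

text \<open>A clipped cosine: continuous, 2-periodic, 0 on [0, 1/3] and 1 on [2/3, 1], because
  \<open>cos (pi / 3) = 1/2\<close>. It tells the ternary digit 0 from the digit 2.\<close>

definition plateau :: "real \<Rightarrow> real" where
  "plateau t = max 0 (min 1 (1/2 - cos (pi * t)))"

lemma continuous_on_plateau: "continuous_on S plateau"
  unfolding plateau_def by (intro continuous_intros)

lemma plateau_bounds: "0 \<le> plateau t" "plateau t \<le> 1"
  by (auto simp: plateau_def)

lemma plateau_periodic: "plateau (2 * of_int k + t) = plateau t"
proof -
  have "cos (pi * (2 * of_int k + t)) = cos (pi * t + 2 * pi * of_int k)"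
    by (simp add: algebra_simps)
  also have "\<dots> = cos (pi * t)"
    by (simp add: cos_add)
  finally show ?thesis by (simp add: plateau_def)
qed

lemma plateau_left:
  assumes "0 \<le> t" "t \<le> 1/3" shows "plateau t = 0"
proof -
  have "pi * t \<le> pi / 3" using assms mult_left_mono[of t "1/3" pi] by simp
  then have "cos (pi * t) \<ge> cos (pi / 3)"
    using assms by (intro cos_monotone_0_pi_le) auto
  then show ?thesis by (simp add: plateau_def cos_60)
qed

lemma plateau_right:
  assumes "2/3 \<le> t" "t \<le> 1" shows "plateau t = 1"
proof -
  \<comment> \<open>Reflection at 1/2 turns the right plateau into the estimate used for the left
    one.\<close>
  have "plateau t = max 0 (min 1 (1/2 + cos (pi * (1 - t))))"
    by (simp add: plateau_def right_diff_distrib cos_diff)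
  moreover have "cos (pi * (1 - t)) \<ge> cos (pi / 3)"
    using assms mult_left_mono[of "1 - t" "1/3" pi] by (intro cos_monotone_0_pi_le) auto
  ultimately show ?thesis by (simp add: cos_60)
qed

text \<open>For digits in {0, 1} this is the point of the Cantor set with ternary digits
  \<open>2 * c j\<close>. Integer digits fit the floors and even shifts below.\<close>

definition ternary :: "(nat \<Rightarrow> int) \<Rightarrow> real" where
  "ternary c = (\<Sum>j. 2 * of_int (c j) / 3 ^ Suc j)"

lemma
  assumes "\<And>j. c j \<in> {0, 1}"
  shows ternary_summable: "summable (\<lambda>j. 2 * of_int (c j) / 3 ^ Suc j :: real)"
    and ternary_bounds: "0 \<le> ternary c" "ternary c \<le> 1"
proof -
  have s: "(\<lambda>j. 2 / 3 ^ Suc j :: real) sums 1"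
    using sums_mult[OF geometric_sums[of "1/3::real"], of "2/3"] by (simp add: power_divide)
  have le: "0 \<le> 2 * of_int (c j) / (3 ^ Suc j :: real)"
    "2 * of_int (c j) / (3 ^ Suc j :: real) \<le> 2 / 3 ^ Suc j" for j
    using assms[of j] by (auto intro!: divide_right_mono)
  show sm: "summable (\<lambda>j. 2 * of_int (c j) / 3 ^ Suc j :: real)"
  proof (rule summable_comparison_test'[OF sums_summable[OF s]])
    show "norm (2 * of_int (c j) / (3 ^ Suc j :: real)) \<le> 2 / 3 ^ Suc j" if "j \<ge> 0" for j
      unfolding real_norm_def abs_of_nonneg[OF le(1)] by (rule le(2))
  qed
  show "0 \<le> ternary c" unfolding ternary_def by (intro suminf_nonneg sm le)
  show "ternary c \<le> 1"
    unfolding ternary_def sums_unique[OF s] by (intro suminf_le sm sums_summable[OF s] le)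
qed

text \<open>Multiplication by 3 moves the leading digit in front of the ternary point; iteration
  exposes any later digit.\<close>

lemma ternary_shift:
  assumes "\<And>j. c j \<in> {0, 1}"
  shows "3 * ternary c = 2 * of_int (c 0) + ternary (c \<circ> Suc)"
proof -
  have "summable (\<lambda>j. 2 * of_int (c (Suc j)) / 3 ^ Suc j :: real)"
    using ternary_summable[of "c \<circ> Suc"] assms by simp
  then have "(\<lambda>j. 1/3 * (2 * of_int (c (Suc j)) / 3 ^ Suc j)) sums (1/3 * ternary (c \<circ> Suc))"
    unfolding ternary_def o_def by (intro sums_mult summable_sums)
  then have "(\<lambda>j. 2 * of_int (c (Suc j)) / 3 ^ Suc (Suc j)) sums (1/3 * ternary (c \<circ> Suc))"
    by simp
  from sums_Suc[OF this] have "ternary c = 1/3 * ternary (c \<circ> Suc) + 2 * of_int (c 0) / 3"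
    unfolding ternary_def[of c] by (auto simp: sums_iff)
  then show ?thesis by simp
qed

text \<open>
  Multiplying by \<open>3 ^ n\<close> moves the first \<open>n\<close> ternary digits into an even integer, and the next
  digit \<open>0\<close> or \<open>2\<close> puts the remainder on the corresponding plateau.
\<close>

lemma plateau_ternary:
  assumes "\<And>j. c j \<in> {0, 1}"
  shows "plateau (3 ^ n * ternary c) = of_int (c n)"
  using assms
proof (induction n arbitrary: c)
  case 0
  have b: "0 \<le> ternary (c \<circ> Suc)" "ternary (c \<circ> Suc) \<le> 1"
    using ternary_bounds[of "c \<circ> Suc"] 0 by auto
  have shift: "3 * ternary c = 2 * of_int (c 0) + ternary (c \<circ> Suc)"
    by (rule ternary_shift) (rule 0)
  consider "c 0 = 0" | "c 0 = 1" using 0[of 0] by auto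
  then show ?case
  proof cases
    case 1
    then show ?thesis using b shift by (simp add: plateau_left)
  next
    case 2
    then show ?thesis using b shift by (simp add: plateau_right)
  qed
next
  case (Suc n)
  have "3 ^ Suc n * ternary c = 3 ^ n * (3 * ternary c)" by simp
  also have "\<dots> = 2 * of_int (3 ^ n * c 0) + 3 ^ n * ternary (c \<circ> Suc)"
    using ternary_shift[of c, OF Suc.prems] by (simp add: algebra_simps)
  finally have "plateau (3 ^ Suc n * ternary c) = plateau (3 ^ n * ternary (c \<circ> Suc))"
    by (simp only: plateau_periodic)
  also have "\<dots> = of_int ((c \<circ> Suc) n)"
    by (rule Suc.IH) (simp add: Suc.prems[simplified])
  finally show ?case by simp
qed

section \<open>Binary digits and Schoenberg's coordinate functions\<close>

definition binary_digit :: "real \<Rightarrow> nat \<Rightarrow> int" where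
  "binary_digit x k = \<lfloor>2 ^ Suc k * x\<rfloor> mod 2"

text \<open>The first n digits sum to the truncation of \<open>x\<close> to n binary places, which
  is within 2^-n of \<open>x\<close>. The bound \<open>x < 1\<close> makes the integer part, the
  case n = 0, vanish.\<close>

lemma binary_expansion:
  assumes "0 \<le> x" "x < 1"
  shows "(\<lambda>k. of_int (binary_digit x k) / 2 ^ Suc k) sums x"
proof -
  have part: "(\<Sum>k<n. of_int (binary_digit x k) / 2 ^ Suc k) = of_int \<lfloor>2 ^ n * x\<rfloor> / (2 ^ n :: real)" for n
  proof (induction n)
    case 0
    have "\<lfloor>x\<rfloor> = 0" using assms by (simp add: floor_eq_iff)
    then show ?case by simp
  next
    case (Suc n)
    have "\<lfloor>2 ^ n * x\<rfloor> = \<lfloor>2 ^ Suc n * x\<rfloor> div 2"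
      using floor_divide_real_eq_div[of 2 "2 ^ Suc n * x"] by simp
    then have "\<lfloor>2 ^ Suc n * x\<rfloor> = 2 * \<lfloor>2 ^ n * x\<rfloor> + binary_digit x n"
      by (simp add: binary_digit_def)
    then show ?case using Suc by (simp add: field_simps)
  qed
  have "(\<lambda>n. of_int \<lfloor>2 ^ n * x\<rfloor> / (2 ^ n :: real)) \<longlonglongrightarrow> x"
  proof (rule tendsto_sandwich)
    show "\<forall>\<^sub>F n in sequentially. x - (1/2) ^ n \<le> of_int \<lfloor>2 ^ n * x\<rfloor> / 2 ^ n"
    proof (intro always_eventually allI)
      fix n
      have "2 ^ n * x - 1 \<le> of_int \<lfloor>2 ^ n * x\<rfloor>" by linarith
      then have "(2 ^ n * x - 1) / 2 ^ n \<le> of_int \<lfloor>2 ^ n * x\<rfloor> / 2 ^ n"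
        by (intro divide_right_mono) auto
      then show "x - (1/2) ^ n \<le> of_int \<lfloor>2 ^ n * x\<rfloor> / 2 ^ n"
        by (simp add: diff_divide_distrib power_divide)
    qed
    show "\<forall>\<^sub>F n in sequentially. of_int \<lfloor>2 ^ n * x\<rfloor> / 2 ^ n \<le> x"
      by (intro always_eventually allI) (simp add: field_simps)
    have "(\<lambda>n. (1/2::real) ^ n) \<longlonglongrightarrow> 0" by (intro LIMSEQ_realpow_zero) auto
    from tendsto_diff[OF tendsto_const this] show "(\<lambda>n. x - (1/2) ^ n) \<longlonglongrightarrow> x" by simp
  qed simp
  then show ?thesis unfolding sums_def part .
qed

text \<open>At a Cantor point the plateau values are its digits; coordinate \<open>i\<close> reads
  those at positions \<open>prod_encode (i, k)\<close> as a binary expansion.\<close>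

definition schoenberg_coord :: "nat \<Rightarrow> real \<Rightarrow> real" where
  "schoenberg_coord i t = (\<Sum>k. plateau (3 ^ prod_encode (i, k) * t) / 2 ^ Suc k)"

text \<open>The terms are dominated by 1/2^(k+1), uniformly in \<open>t\<close>: the Weierstrass
  test gives continuity, and the majorant's sum 1 the upper bound.\<close>

lemma
  shows continuous_on_schoenberg_coord: "continuous_on UNIV (schoenberg_coord i)"
    and schoenberg_coord_bounds: "0 \<le> schoenberg_coord i t" "schoenberg_coord i t \<le> 1"
proof -
  have s: "(\<lambda>k. 1 / 2 ^ Suc k :: real) sums 1"
    using power_half_series by (simp add: power_divide)
  have le: "0 \<le> plateau (3 ^ prod_encode (i, k) * t) / 2 ^ Suc k"
    "plateau (3 ^ prod_encode (i, k) * t) / 2 ^ Suc k \<le> 1 / 2 ^ Suc k" for k t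
    using plateau_bounds by (auto intro!: divide_right_mono)
  have norm_le: "norm (plateau (3 ^ prod_encode (i, k) * t) / 2 ^ Suc k) \<le> 1 / 2 ^ Suc k" for k t
    unfolding real_norm_def abs_of_nonneg[OF le(1)] by (rule le(2))
  have sm: "summable (\<lambda>k. plateau (3 ^ prod_encode (i, k) * t) / 2 ^ Suc k)" for t
  proof (rule summable_comparison_test'[OF sums_summable[OF s]])
    show "norm (plateau (3 ^ prod_encode (i, k) * t) / 2 ^ Suc k) \<le> 1 / 2 ^ Suc k" if "0 \<le> k" for k
      by (rule norm_le)
  qed
  show "0 \<le> schoenberg_coord i t"
    unfolding schoenberg_coord_def by (intro suminf_nonneg sm le)
  show "schoenberg_coord i t \<le> 1"
    unfolding schoenberg_coord_def using suminf_le[OF le(2) sm sums_summable[OF s]] sums_unique[OF s]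
    by simp
  have "uniform_limit UNIV
      (\<lambda>n t. \<Sum>k<n. plateau (3 ^ prod_encode (i, k) * t) / 2 ^ Suc k) (schoenberg_coord i) sequentially"
    unfolding schoenberg_coord_def
  proof (rule Weierstrass_m_test[OF _ sums_summable[OF s]])
    show "norm (plateau (3 ^ prod_encode (i, k) * t) / 2 ^ Suc k) \<le> 1 / 2 ^ Suc k" for k t
      by (rule norm_le)
  qed
  then show "continuous_on UNIV (schoenberg_coord i)"
    by (rule uniform_limit_theorem[rotated])
       (auto intro!: always_eventually continuous_intros continuous_on_compose2[OF continuous_on_plateau[of UNIV]])
qed

text \<open>
  Schoenberg's space-filling curve. The digit positions are distributed to the coordinates by the
  pairing function.
\<close>

lemma space_filling_curve:
  fixes R :: real
  obtains g :: "real \<Rightarrow> 'a::euclidean_space" and s :: "'a \<Rightarrow> real"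
  where "continuous_on UNIV g" "bounded (range g)" "s \<in> borel_measurable borel"
    "\<And>z. 0 \<le> s z \<and> s z \<le> 1" "\<And>z. norm z \<le> R \<Longrightarrow> g (s z) = z"
proof -
  \<comment> \<open>Strictly above \<open>R\<close>, so that the rescaled coordinates of points of
    the ball stay below 1, as the binary expansion requires.\<close>
  define L where "L = \<bar>R\<bar> + 1"
  have L: "L > 0" "R < L" by (auto simp: L_def)
  define i where "i = to_nat_on (Basis :: 'a set)"
  define g where "g t = (\<Sum>b\<in>Basis. (L * (2 * schoenberg_coord (i b) t - 1)) *\<^sub>R (b :: 'a))" for t
  \<comment> \<open>The binary digits of all rescaled coordinates are interleaved into one sequence.
    Positions that belong to no basis vector hold digits that \<open>g\<close> never reads.\<close>
  define c where "c z j = (case prod_decode j of (m, k) \<Rightarrow>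
    binary_digit ((z \<bullet> from_nat_into (Basis :: 'a set) m / L + 1) / 2) k)" for z j
  define s where "s z = ternary (c z)" for z
  have c: "c z j \<in> {0, 1}" for z j
    by (auto simp: c_def binary_digit_def split: prod.split)
  have 1: "continuous_on UNIV g"
    unfolding g_def by (intro continuous_intros continuous_on_schoenberg_coord)
  have "norm (g t) \<le> (\<Sum>b\<in>(Basis :: 'a set). L)" for t
    unfolding g_def
  proof (rule sum_norm_le)
    fix b :: 'a assume "b \<in> Basis"
    have "\<bar>2 * schoenberg_coord (i b) t - 1\<bar> \<le> 1"
      using schoenberg_coord_bounds[of "i b" t] by auto
    then have "L * \<bar>2 * schoenberg_coord (i b) t - 1\<bar> \<le> L * 1"
      using L by (intro mult_left_mono) auto
    then show "norm ((L * (2 * schoenberg_coord (i b) t - 1)) *\<^sub>R b) \<le> L"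
      using \<open>b \<in> Basis\<close> L by (simp add: abs_mult)
  qed
  then have 2: "bounded (range g)" by (auto simp: bounded_iff)
  have 3: "s \<in> borel_measurable borel"
    unfolding s_def ternary_def c_def binary_digit_def by measurable
  have 4: "0 \<le> s z \<and> s z \<le> 1" for z
    unfolding s_def using ternary_bounds[OF c] by auto
  have 5: "g (s z) = z" if "norm z \<le> R" for z
  proof -
    have "L * (2 * schoenberg_coord (i b) (s z) - 1) = z \<bullet> b" if b: "b \<in> Basis" for b
    proof -
      define x where "x = (z \<bullet> b / L + 1) / 2"
      have "\<bar>z \<bullet> b\<bar> < L" using Basis_le_norm[OF b, of z] L \<open>norm z \<le> R\<close> by auto
      then have x: "0 \<le> x" "x < 1"
        using L by (auto simp: x_def field_simps)
      have "from_nat_into Basis (i b) = b"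
        using b by (simp add: i_def countable_finite)
      then have digit: "c z (prod_encode (i b, k)) = binary_digit x k" for k
        by (simp add: c_def x_def)
      have "plateau (3 ^ prod_encode (i b, k) * s z) = of_int (binary_digit x k)" for k
        unfolding s_def plateau_ternary[of "c z", OF c] digit ..
      then have "schoenberg_coord (i b) (s z) = x"
        using binary_expansion[OF x] by (simp only: schoenberg_coord_def sums_iff)
      then show ?thesis using L by (simp add: x_def field_simps)
    qed
    then show ?thesis
      unfolding g_def by (simp add: euclidean_representation)
  qed
  from that[OF 1 2 3 4 5] show thesis .
qed

section \<open>Weak compactness on bounded sets\<close>

text \<open>Push forward by the section \<open>s\<close> to [0, 1], where tightness is automatic,
  extract a weakly convergent subsequence, and push its limit back by \<open>g\<close>. Since
  \<open>g (s z) = z\<close> almost surely, integrals of \<open>f\<close> become integrals of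
  \<open>f \<circ> g\<close> on the line.\<close>

lemma bounded_prob_weak_compactness:
  fixes M :: "nat \<Rightarrow> 'a::euclidean_space measure"
  assumes M: "\<And>n. prob_space (M n)" "\<And>n. sets (M n) = sets borel"
    and bdd: "\<And>n. AE z in M n. norm z \<le> R"
  obtains r M' where "strict_mono r" "prob_space M'" "sets M' = sets borel"
    "\<And>f :: 'a \<Rightarrow> real. continuous_on UNIV f \<Longrightarrow> (\<lambda>n. \<integral>z. f z \<partial>M (r n)) \<longlonglongrightarrow> (\<integral>z. f z \<partial>M')"
proof -
  obtain g :: "real \<Rightarrow> 'a" and s where g: "continuous_on UNIV g" "bounded (range g)"
    and s[measurable]: "s \<in> borel_measurable borel"
    and s01: "\<And>z. 0 \<le> s z \<and> s z \<le> 1" and gs: "\<And>z. norm z \<le> R \<Longrightarrow> g (s z) = z"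
    using space_filling_curve[of R] by blast
  have [measurable]: "g \<in> borel_measurable borel"
    using g(1) by (rule borel_measurable_continuous_onI)
  have [measurable_cong]: "sets (M n) = sets borel" for n by (rule M)
  define N where "N n = distr (M n) borel s" for n
  have N: "real_distribution (N n)" for n
    unfolding N_def real_distribution_def real_distribution_axioms_def
    by (auto intro!: prob_space.prob_space_distr M)
  \<comment> \<open>Tightness is formulated with half-open intervals; the left end -1 keeps the
    point 0 inside.\<close>
  have "measure (N n) {-1<..1} = 1" for n
  proof -
    interpret prob_space "M n" by (rule M)
    have "s z \<in> {-1<..1}" for z using s01[of z] by auto
    then have "s -` {-1<..1} \<inter> space (M n) = space (M n)" by blast
    then show ?thesis unfolding N_def by (simp add: measure_distr prob_space)
  qed
  then have "tight N"
    unfolding tight_def using N by (intro conjI allI impI exI[of _ "-1"] exI[of _ 1]) auto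
  from tight_imp_convergent_subsubsequence[OF this strict_mono_id]
  obtain r N' where r: "strict_mono r" and N': "real_distribution N'"
    and conv: "weak_conv_m (N \<circ> r) N'" by auto
  interpret N': real_distribution N' by (rule N')
  have "(\<lambda>n. \<integral>z. f z \<partial>M (r n)) \<longlonglongrightarrow> (\<integral>z. f z \<partial>distr N' borel g)"
    if f: "continuous_on UNIV f" for f :: "'a \<Rightarrow> real"
  proof -
    have [measurable]: "f \<in> borel_measurable borel"
      using f by (rule borel_measurable_continuous_onI)
    \<comment> \<open>Only values on the bounded range of \<open>g\<close> enter, so even an
      unbounded \<open>f\<close> gives a bounded continuous integrand on the line.\<close>
    have "compact (f ` closure (range g))"
      using g(2) f by (intro compact_continuous_image) (auto intro: continuous_on_subset)
    then have "bounded (f ` closure (range g))" by (rule compact_imp_bounded)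
    then obtain B where "\<forall>y\<in>f ` closure (range g). norm y \<le> B"
      unfolding bounded_iff by blast
    moreover have "g t \<in> closure (range g)" for t
      by (rule subsetD[OF closure_subset]) simp
    ultimately have B: "\<And>t. norm (f (g t)) \<le> B" by blast
    have "continuous_on UNIV (\<lambda>t. f (g t))"
      using continuous_on_compose2[OF f g(1)] by simp
    then have cont: "isCont (\<lambda>t. f (g t)) t" for t
      by (simp add: continuous_on_eq_continuous_at)
    have "(\<lambda>n. \<integral>t. f (g t) \<partial>(N \<circ> r) n) \<longlonglongrightarrow> (\<integral>t. f (g t) \<partial>N')"
      using N N' conv B cont
      by (intro weak_conv_imp_integral_bdd_continuous_conv[where B = B]) (auto simp: o_def)
    moreover have "(\<integral>t. f (g t) \<partial>(N \<circ> r) n) = (\<integral>z. f z \<partial>M (r n))" for n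
    proof -
      have "AE z in M (r n). f (g (s z)) = f z" using bdd[of "r n"] by eventually_elim (simp add: gs)
      then show ?thesis
        unfolding N_def o_def by (subst integral_distr) (auto intro!: integral_cong_AE)
    qed
    ultimately show ?thesis by (simp add: integral_distr)
  qed
  moreover have "prob_space (distr N' borel g)"
    by (intro N'.prob_space_distr) auto
  ultimately show thesis using r that by simp
qed

text \<open>Closed sets form an intersection-stable generator, and the indicator of a closed set is
  a pointwise limit of continuous functions with values in [0, 1].\<close>

lemma prob_measure_eqI_continuous:
  fixes M N :: "'a::metric_space measure"
  assumes "prob_space M" "prob_space N" and sM: "sets M = sets borel" and sN: "sets N = sets borel"
    and eq: "\<And>f :: 'a \<Rightarrow> real. continuous_on UNIV f \<Longrightarrow> (\<And>x. \<bar>f x\<bar> \<le> 1) \<Longrightarrow> (\<integral>x. f x \<partial>M) = (\<integral>x. f x \<partial>N)"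
  shows "M = N"
proof -
  interpret M: prob_space M by fact
  interpret N: prob_space N by fact
  note [measurable_cong] = sM sN
  have closed_eq: "emeasure M F = emeasure N F" if F: "closed F" for F :: "'a set"
  \<comment> \<open>By convention \<open>infdist\<close> to the empty set is 0, so for empty
    \<open>F\<close> the functions \<open>f k\<close> would all be constantly 1.\<close>
  proof (cases "F = {}")
    case False
    define f where "f k x = max 0 (1 - real k * infdist x F)" for k x
    have bnd: "\<bar>f k x\<bar> \<le> 1" for k x
      using infdist_nonneg[of x F] by (auto simp: f_def abs_if)
    have cont: "continuous_on UNIV (f k)" for k
      unfolding f_def by (intro continuous_intros)
    have [measurable]: "f k \<in> borel_measurable borel" for k
      using cont by (rule borel_measurable_continuous_onI)
    have [measurable]: "F \<in> sets borel" using F by simp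
    have lim: "(\<lambda>k. f k x) \<longlonglongrightarrow> indicator F x" for x
    proof (cases "x \<in> F")
      case True
      then show ?thesis by (simp add: f_def)
    next
      case notin: False
      then have pos: "infdist x F > 0"
        using F False by (metis in_closed_iff_infdist_zero infdist_nonneg less_eq_real_def)
      obtain k0 where k0: "real k0 * infdist x F > 1"
        using reals_Archimedean3[OF pos] by blast
      have "f k x = 0" if "k \<ge> k0" for k
      proof -
        have "real k0 * infdist x F \<le> real k * infdist x F"
          using that pos by (intro mult_right_mono) auto
        then show ?thesis using k0 by (simp add: f_def)
      qed
      then have "\<forall>\<^sub>F k in sequentially. f k x = 0"
        by (auto simp: eventually_sequentially)
      then show ?thesis using notin by (simp add: tendsto_eventually)
    qed
    have "(\<lambda>k. \<integral>x. f k x \<partial>M) \<longlonglongrightarrow> (\<integral>x. indicator F x \<partial>M)"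
      by (rule integral_dominated_convergence[where w = "\<lambda>_. 1"]) (auto intro: bnd lim)
    moreover have "(\<lambda>k. \<integral>x. f k x \<partial>N) \<longlonglongrightarrow> (\<integral>x. indicator F x \<partial>N)"
      by (rule integral_dominated_convergence[where w = "\<lambda>_. 1"]) (auto intro: bnd lim)
    moreover have "(\<integral>x. f k x \<partial>M) = (\<integral>x. f k x \<partial>N)" for k
      by (rule eq[OF cont bnd])
    ultimately have "(\<integral>x. indicator F x \<partial>M) = (\<integral>x. indicator F x \<partial>N :: real)"
      using LIMSEQ_unique by auto
    then show ?thesis by (simp add: M.emeasure_eq_measure N.emeasure_eq_measure)
  qed simp
  have gen: "sets borel = sigma_sets UNIV (Collect (closed :: 'a set \<Rightarrow> bool))"
    unfolding borel_eq_closed by simp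
  show ?thesis
    by (rule measure_eqI_generator_eq[where E = "Collect closed" and \<Omega> = UNIV and A = "\<lambda>_. UNIV"])
       (auto simp: Int_stable_def closed_eq sM sN gen)
qed

text \<open>The complement of the support is a union of open null sets; the Lindelof property
  reduces it to a countable union.\<close>

lemma AE_in_measure_support:
  fixes \<mu> :: "'a::second_countable_topology measure"
  assumes "sets \<mu> = sets borel"
  shows "AE x in \<mu>. x \<in> measure_support \<mu>"
proof -
  define F where "F = {U. open U \<and> emeasure \<mu> U = 0}"
  obtain F' where F': "F' \<subseteq> F" "countable F'" "\<Union>F' = \<Union>F"
    using Lindelof[of F] by (auto simp: F_def)
  have "AE x in \<mu>. \<forall>U\<in>F'. x \<notin> U"
    unfolding AE_ball_countable[OF F'(2)]
  proof
    fix U assume "U \<in> F'"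
    then have "U \<in> null_sets \<mu>" using F' assms by (auto simp: F_def null_sets_def)
    then show "AE x in \<mu>. x \<notin> U" by (rule AE_not_in)
  qed
  then show ?thesis
  proof eventually_elim
    case (elim x)
    then have "x \<notin> \<Union>F" using F'(3) by blast
    then show ?case by (auto simp: F_def measure_support_def zero_less_iff_neq_zero)
  qed
qed

section \<open>Relative entropy and product densities\<close>

text \<open>Both signs come from \<open>ln u \<le> u - 1\<close>, taken at \<open>x\<close> and at
  \<open>1 / x\<close>.\<close>

lemma abs_mult_ln_le:
  assumes "0 \<le> x" "x \<le> (C :: real)"
  shows "\<bar>x * ln x\<bar> \<le> 1 + C\<^sup>2"
proof (cases "x = 0")
  case False
  with assms have x: "x > 0" by simp
  have "x * ln x \<le> x * (x - 1)"
    using x by (intro mult_left_mono ln_le_minus_one) auto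
  also have "\<dots> \<le> C\<^sup>2"
    using assms mult_mono[of x C x C] by (simp add: power2_eq_square algebra_simps)
  finally have up: "x * ln x \<le> C\<^sup>2" .
  have "- ln x \<le> 1 / x - 1"
    using ln_le_minus_one[of "1 / x"] x by (simp add: ln_div)
  then have "x * (- ln x) \<le> x * (1 / x - 1)"
    using x by (intro mult_left_mono) auto
  then have "- (x * ln x) \<le> 1"
    using x by (simp add: algebra_simps)
  with up show ?thesis by (simp add: abs_le_iff add_increasing add_increasing2)
qed simp

text \<open>Gibbs' inequality. Its version for densities applies once \<open>P\<close> is written
  with a real-valued nonnegative version \<open>D\<close> of the Radon-Nikodym derivative.\<close>

lemma KL_nonneg:
  assumes "prob_space P" "prob_space Q" "sets P = sets Q"
  shows "0 \<le> KL P Q"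
proof (cases "absolutely_continuous Q P \<and> integrable P (entropy_density (exp 1) Q P)")
  case True
  interpret P: prob_space P by fact
  interpret Q: prob_space Q by fact
  interpret information_space Q "exp 1" by unfold_locales simp
  have "finite_measure P" by unfold_locales
  from Q.real_RN_deriv[OF this] True assms(3) obtain D
    where D: "D \<in> borel_measurable Q" "AE x in Q. RN_deriv Q P x = ennreal (D x)"
      "AE x in P. 0 < D x" "\<And>x. 0 \<le> D x"
    by auto
  have "P = density Q (RN_deriv Q P)"
    using True assms(3) by (intro Q.density_RN_deriv[symmetric]) auto
  also have "\<dots> = density Q D"
    using D by (auto intro!: density_cong)
  finally have P: "P = density Q D" .
  have "AE x in P. RN_deriv Q P x = ennreal (D x)"
    using absolutely_continuous_AE[OF assms(3) _ D(2)] True by simp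
  then have eq: "AE x in P. log (exp 1) (D x) = entropy_density (exp 1) Q P x"
    by eventually_elim (simp add: entropy_density_def D)
  have [measurable_cong]: "sets P = sets Q" by fact
  have [measurable]: "D \<in> borel_measurable Q" by fact
  have "integrable P (\<lambda>x. log (exp 1) (D x))"
    by (rule integrable_cong_AE[THEN iffD2, OF _ _ eq conjunct2[OF True]]) auto
  then have "integrable Q (\<lambda>x. D x * log (exp 1) (D x))"
    using D by (subst integrable_real_density[symmetric]) (auto simp: P[symmetric] comp_def)
  then have "0 \<le> KL_divergence (exp 1) Q P"
    using D assms(1) unfolding P by (intro KL_nonneg) auto
  then show ?thesis by (simp add: KL_def True)
qed (auto simp: KL_def)

text \<open>A bounded density makes \<open>f x * ln (f x)\<close> bounded, hence integrable over a
  probability space.\<close>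

lemma KL_density_finite:
  assumes "prob_space Q" and f[measurable]: "f \<in> borel_measurable Q"
    and bnd: "\<And>x. 0 \<le> f x" "\<And>x. f x \<le> (C :: real)"
  shows "KL (density Q f) Q \<noteq> \<infinity>"
proof -
  interpret Q: prob_space Q by fact
  let ?e = "entropy_density (exp 1) Q (density Q f)"
  have ac: "absolutely_continuous Q (density Q f)"
    by (rule absolutely_continuousI_density) simp
  have "AE x in Q. RN_deriv Q (density Q f) x = ennreal (f x)"
    by (rule AE_symmetric[OF Q.RN_deriv_unique]) auto
  then have eq: "AE x in Q. f x * ?e x = f x * ln (f x)"
    by eventually_elim (simp add: entropy_density_def bnd log_def)
  have "integrable Q (\<lambda>x. f x * ln (f x))"
    using abs_mult_ln_le bnd by (intro Q.integrable_const_bound[where B = "1 + C\<^sup>2"]) auto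
  then have "integrable Q (\<lambda>x. f x * ?e x)"
    by (subst integrable_cong_AE[OF _ _ eq]) auto
  then have "integrable (density Q f) ?e"
    using bnd by (subst integrable_real_density) auto
  with ac show ?thesis by (simp add: KL_def)
qed

text \<open>Tonelli: integrating over the second factor first leaves the indicator of
  \<open>X\<close>, since almost every fibre has mass one.\<close>

lemma distr_fst_density:
  assumes "sigma_finite_measure N" and [measurable]: "D \<in> borel_measurable (M \<Otimes>\<^sub>M N)"
    and one: "AE x in M. (\<integral>\<^sup>+y. D (x, y) \<partial>N) = 1"
  shows "distr (density (M \<Otimes>\<^sub>M N) D) M fst = M"
proof (rule measure_eqI)
  interpret N: sigma_finite_measure N by fact
  fix X assume "X \<in> sets (distr (density (M \<Otimes>\<^sub>M N) D) M fst)"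
  then have [measurable]: "X \<in> sets M" by simp
  have "emeasure (distr (density (M \<Otimes>\<^sub>M N) D) M fst) X =
      (\<integral>\<^sup>+z. D z * indicator (fst -` X \<inter> space (M \<Otimes>\<^sub>M N)) z \<partial>(M \<Otimes>\<^sub>M N))"
    by (simp add: emeasure_distr emeasure_density)
  also have "\<dots> = (\<integral>\<^sup>+z. D z * indicator X (fst z) \<partial>(M \<Otimes>\<^sub>M N))"
    by (intro nn_integral_cong) (auto split: split_indicator)
  also have "\<dots> = (\<integral>\<^sup>+x. (\<integral>\<^sup>+y. D (x, y) * indicator X x \<partial>N) \<partial>M)"
    by (subst N.nn_integral_fst[symmetric]) auto
  also have "\<dots> = (\<integral>\<^sup>+x. (\<integral>\<^sup>+y. D (x, y) \<partial>N) * indicator X x \<partial>M)"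
    by (intro nn_integral_cong nn_integral_multc) auto
  also have "\<dots> = (\<integral>\<^sup>+x. indicator X x \<partial>M)"
  proof (rule nn_integral_cong_AE)
    show "AE x in M. (\<integral>\<^sup>+y. D (x, y) \<partial>N) * indicator X x = indicator X x"
      using one by eventually_elim simp
  qed
  finally show "emeasure (distr (density (M \<Otimes>\<^sub>M N) D) M fst) X = emeasure M X" by simp
qed simp

lemma distr_snd_density:
  assumes "sigma_finite_measure M" "sigma_finite_measure N"
    and [measurable]: "D \<in> borel_measurable (M \<Otimes>\<^sub>M N)"
    and one: "AE y in N. (\<integral>\<^sup>+x. D (x, y) \<partial>M) = 1"
  shows "distr (density (M \<Otimes>\<^sub>M N) D) N snd = N"
proof (rule measure_eqI)
  interpret pair_sigma_finite M N using assms(1,2) by (rule pair_sigma_finite.intro)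
  fix X assume "X \<in> sets (distr (density (M \<Otimes>\<^sub>M N) D) N snd)"
  then have [measurable]: "X \<in> sets N" by simp
  have "emeasure (distr (density (M \<Otimes>\<^sub>M N) D) N snd) X =
      (\<integral>\<^sup>+z. D z * indicator (snd -` X \<inter> space (M \<Otimes>\<^sub>M N)) z \<partial>(M \<Otimes>\<^sub>M N))"
    by (simp add: emeasure_distr emeasure_density)
  also have "\<dots> = (\<integral>\<^sup>+z. D z * indicator X (snd z) \<partial>(M \<Otimes>\<^sub>M N))"
    by (intro nn_integral_cong) (auto split: split_indicator)
  also have "\<dots> = (\<integral>\<^sup>+y. (\<integral>\<^sup>+x. D (x, y) * indicator X y \<partial>M) \<partial>N)"
    by (subst nn_integral_snd[symmetric]) auto
  also have "\<dots> = (\<integral>\<^sup>+y. (\<integral>\<^sup>+x. D (x, y) \<partial>M) * indicator X y \<partial>N)"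
    by (intro nn_integral_cong nn_integral_multc) auto
  also have "\<dots> = (\<integral>\<^sup>+y. indicator X y \<partial>N)"
  proof (rule nn_integral_cong_AE)
    show "AE y in N. (\<integral>\<^sup>+x. D (x, y) \<partial>M) * indicator X y = indicator X y"
      using one by eventually_elim simp
  qed
  finally show "emeasure (distr (density (M \<Otimes>\<^sub>M N) D) N snd) X = emeasure N X" by simp
qed simp

section \<open>Integrals of cellwise constant functions and quantization\<close>

lemma
  fixes s :: "'c \<Rightarrow> real"
  assumes "prob_space N" and q[measurable]: "q \<in> measurable N (count_space UNIV)"
    and J: "finite J" "\<And>x. q x \<in> J"
  shows integrable_finite_range: "integrable N (\<lambda>x. s (q x))"
    and integral_finite_range: "(\<integral>x. s (q x) \<partial>N) = (\<Sum>j\<in>J. s j * measure N {x \<in> space N. q x = j})"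
proof -
  interpret prob_space N by fact
  have eq: "s (q x) = (\<Sum>j\<in>J. s j * indicator {x \<in> space N. q x = j} x)" if "x \<in> space N" for x
  proof -
    have "(\<Sum>j\<in>J. s j * indicator {x \<in> space N. q x = j} x) = (\<Sum>j\<in>J. if j = q x then s j else 0)"
      using that by (intro sum.cong) (auto split: split_indicator)
    then show ?thesis using J by simp
  qed
  have "integrable N (\<lambda>x. \<Sum>j\<in>J. s j * indicator {x \<in> space N. q x = j} x)"
    by (intro Bochner_Integration.integrable_sum integrable_mult_right integrable_real_indicator)
       (auto simp: emeasure_eq_measure)
  then show "integrable N (\<lambda>x. s (q x))"
    by (subst Bochner_Integration.integrable_cong[OF refl eq]) auto
  have "(\<integral>x. s (q x) \<partial>N) = (\<integral>x. (\<Sum>j\<in>J. s j * indicator {x \<in> space N. q x = j} x) \<partial>N)"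
    by (intro Bochner_Integration.integral_cong refl eq)
  also have "\<dots> = (\<Sum>j\<in>J. (\<integral>x. s j * indicator {x \<in> space N. q x = j} x \<partial>N))"
    by (intro Bochner_Integration.integral_sum integrable_mult_right integrable_real_indicator)
       (auto simp: emeasure_eq_measure)
  also have "\<dots> = (\<Sum>j\<in>J. s j * measure N {x \<in> space N. q x = j})"
    by (intro sum.cong refl) simp
  finally show "(\<integral>x. s (q x) \<partial>N) = (\<Sum>j\<in>J. s j * measure N {x \<in> space N. q x = j})" .
qed

text \<open>Total boundedness supplies finitely many centres, and a point is sent to the first
  centre near it; taking the least index keeps the choice measurable.\<close>

lemma finite_quantizer:
  fixes K :: "'a::{metric_space, second_countable_topology} set"
  assumes "compact K" "d > 0"
  obtains q :: "'a \<Rightarrow> nat" and c k where "q \<in> measurable borel (count_space UNIV)"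
    "\<And>x. q x \<le> k" "\<And>x. x \<in> K \<Longrightarrow> c (q x) \<in> K \<and> dist x (c (q x)) < d"
proof -
  obtain F where F: "finite F" "F \<subseteq> K" "K \<subseteq> (\<Union>x\<in>F. ball x d)"
    using seq_compact_imp_totally_bounded[of K] compact_imp_seq_compact[OF assms(1)] assms(2) by metis
  then obtain k and c :: "nat \<Rightarrow> 'a" where c: "F = c ` {i. i < k}"
    using finite_imp_nat_seg_image_inj_on[OF F(1)] by blast
  \<comment> \<open>The alternative \<open>i \<ge> k\<close> makes the minimum exist everywhere:
    index \<open>k\<close> collects the points far from all centres.\<close>
  define q where "q x = (LEAST i. i \<ge> k \<or> dist x (c i) < d)" for x
  have 1: "q \<in> measurable borel (count_space UNIV)"
    unfolding q_def by measurable
  have 2: "q x \<le> k" for x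
    unfolding q_def by (rule Least_le) simp
  have 3: "c (q x) \<in> K \<and> dist x (c (q x)) < d" if "x \<in> K" for x
  proof -
    obtain i where i: "i < k" "dist x (c i) < d"
      using F(3) c \<open>x \<in> K\<close> by (auto simp: dist_commute)
    then have "q x \<le> i" unfolding q_def by (intro Least_le) simp
    moreover have "q x \<ge> k \<or> dist x (c (q x)) < d"
      unfolding q_def by (rule LeastI[of _ k]) simp
    ultimately show ?thesis using i c F(2) by auto
  qed
  from that[OF 1 2 3] show thesis .
qed

section \<open>Couplings of boundedly supported measures\<close>

text \<open>Compact support enters as an almost sure bound with one radius for both marginals; this
  form passes directly to couplings.\<close>

locale bounded_marginals =
  fixes \<mu>0 :: "'a::euclidean_space measure" and \<mu>1 :: "'b::euclidean_space measure" and R :: real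
  assumes prob0: "prob_space \<mu>0" and prob1: "prob_space \<mu>1"
    and sets0 [measurable_cong, simp]: "sets \<mu>0 = sets borel"
    and sets1 [measurable_cong, simp]: "sets \<mu>1 = sets borel"
    and bounded0: "AE x in \<mu>0. norm x \<le> R" and bounded1: "AE y in \<mu>1. norm y \<le> R"
begin

lemma space0 [simp]: "space \<mu>0 = UNIV" and space1 [simp]: "space \<mu>1 = UNIV"
  using sets_eq_imp_space_eq[OF sets0] sets_eq_imp_space_eq[OF sets1] by auto

sublocale \<mu>0: prob_space \<mu>0 by (rule prob0)
sublocale \<mu>1: prob_space \<mu>1 by (rule prob1)
sublocale P: pair_prob_space \<mu>0 \<mu>1 ..

lemma sets_product: "sets (\<mu>0 \<Otimes>\<^sub>M \<mu>1) = sets borel"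
  using sets_pair_measure_cong[OF sets0 sets1] by (simp only: borel_prod)

definition K :: "('a \<times> 'b) set" where "K = cball 0 R \<times> cball 0 R"

lemma compact_K: "compact K"
  unfolding K_def by (intro compact_Times compact_cball)

context
  fixes \<pi> assumes \<pi>: "\<pi> \<in> couplings \<mu>0 \<mu>1"
begin

lemma coupling_prob: "prob_space \<pi>" and coupling_sets: "sets \<pi> = sets borel"
  and coupling_fst: "distr \<pi> borel fst = \<mu>0" and coupling_snd: "distr \<pi> borel snd = \<mu>1"
  using \<pi> by (auto simp: couplings_def)

lemma coupling_space: "space \<pi> = UNIV"
  using sets_eq_imp_space_eq[OF coupling_sets] by simp

lemma coupling_measurable:
  fixes f :: "'a \<times> 'b \<Rightarrow> 'c::{banach, second_countable_topology}"
  assumes "continuous_on UNIV f" shows "f \<in> borel_measurable \<pi>"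
  unfolding measurable_cong_sets[OF coupling_sets refl] by (rule borel_measurable_continuous_onI[OF assms])

lemma coupling_measurable_fst: "fst \<in> borel_measurable \<pi>"
  and coupling_measurable_snd: "snd \<in> borel_measurable \<pi>"
  by (auto intro!: coupling_measurable continuous_intros)

lemma coupling_AE: "AE z in \<pi>. z \<in> K"
proof -
  note [measurable] = coupling_measurable_fst coupling_measurable_snd
  have "AE z in \<pi>. norm (fst z) \<le> R"
    using bounded0 unfolding coupling_fst[symmetric] by (subst (asm) AE_distr_iff) auto
  moreover have "AE z in \<pi>. norm (snd z) \<le> R"
    using bounded1 unfolding coupling_snd[symmetric] by (subst (asm) AE_distr_iff) auto
  ultimately show ?thesis by eventually_elim (auto simp: K_def mem_Times_iff)
qed

text \<open>Continuous integrands may be unbounded, but the compact set \<open>K\<close> carries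
  every coupling.\<close>

lemma coupling_integrable:
  fixes f :: "'a \<times> 'b \<Rightarrow> 'c::{banach, second_countable_topology}"
  assumes "continuous_on UNIV f" shows "integrable \<pi> f"
proof -
  interpret prob_space \<pi> by (rule coupling_prob)
  have "bounded (f ` K)"
    using assms compact_K
    by (intro compact_imp_bounded compact_continuous_image) (auto intro: continuous_on_subset)
  then obtain B where B: "\<And>z. z \<in> K \<Longrightarrow> norm (f z) \<le> B" by (auto simp: bounded_iff)
  show ?thesis
    using coupling_AE coupling_measurable[OF assms]
    by (intro integrable_const_bound[where B = B]) (auto elim!: eventually_mono intro: B)
qed

lemma coupling_integral_bound:
  fixes f :: "'a \<times> 'b \<Rightarrow> 'c::{banach, second_countable_topology}"
  assumes "continuous_on UNIV f" "\<And>z. z \<in> K \<Longrightarrow> norm (f z) \<le> B"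
  shows "norm (\<integral>z. f z \<partial>\<pi>) \<le> B"
proof -
  interpret prob_space \<pi> by (rule coupling_prob)
  have "norm (\<integral>z. f z \<partial>\<pi>) \<le> (\<integral>z. norm (f z) \<partial>\<pi>)"
    by (rule integral_norm_bound)
  also have "\<dots> \<le> B"
    using coupling_AE
    by (intro integral_le_const integrable_norm coupling_integrable assms(1))
       (auto elim!: eventually_mono intro: assms(2))
  finally show ?thesis .
qed

end

text \<open>The common bounded set \<open>K\<close> yields a weak limit. Its marginals are right
  because integrals of functions of one coordinate are constant along the sequence.\<close>

lemma couplings_weakly_compact:
  assumes "\<And>n. \<pi> n \<in> couplings \<mu>0 \<mu>1"
  obtains r \<pi>' where "strict_mono (r :: nat \<Rightarrow> nat)" "\<pi>' \<in> couplings \<mu>0 \<mu>1"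
    "\<And>f :: 'a \<times> 'b \<Rightarrow> real. continuous_on UNIV f \<Longrightarrow>
      (\<lambda>n. \<integral>z. f z \<partial>\<pi> (r n)) \<longlonglongrightarrow> (\<integral>z. f z \<partial>\<pi>')"
proof -
  note prob = coupling_prob[OF assms] and sets = coupling_sets[OF assms]
  note [measurable] = coupling_measurable_fst[OF assms] coupling_measurable_snd[OF assms]
  have "bounded K" using compact_K by (rule compact_imp_bounded)
  then obtain B where B: "\<And>z. z \<in> K \<Longrightarrow> norm z \<le> B" by (auto simp: bounded_iff)
  have "AE z in \<pi> n. norm z \<le> B" for n
    using coupling_AE[OF assms] by eventually_elim (rule B)
  then obtain r \<pi>' where r: "strict_mono (r :: nat \<Rightarrow> nat)" and \<pi>': "prob_space \<pi>'" "sets \<pi>' = sets borel"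
    and conv: "\<And>f :: 'a \<times> 'b \<Rightarrow> real. continuous_on UNIV f \<Longrightarrow>
      (\<lambda>n. \<integral>z. f z \<partial>\<pi> (r n)) \<longlonglongrightarrow> (\<integral>z. f z \<partial>\<pi>')"
    by (rule bounded_prob_weak_compactness[OF prob sets]) (rule that; assumption)
  have [measurable]: "fst \<in> borel_measurable \<pi>'" "snd \<in> borel_measurable \<pi>'"
    unfolding measurable_cong_sets[OF \<pi>'(2) refl]
    by (auto intro!: borel_measurable_continuous_onI continuous_intros)
  interpret \<pi>': prob_space \<pi>' by fact
  have "distr \<pi>' borel fst = \<mu>0"
  proof (rule prob_measure_eqI_continuous)
    fix f :: "'a \<Rightarrow> real" assume f: "continuous_on UNIV f"
    note [measurable] = borel_measurable_continuous_onI[OF f]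
    have "(\<integral>z. f (fst z) \<partial>\<pi> n) = (\<integral>x. f x \<partial>\<mu>0)" for n
      unfolding coupling_fst[OF assms, of n, symmetric] by (subst integral_distr) auto
    with conv[of "\<lambda>z. f (fst z)"] have "(\<integral>z. f (fst z) \<partial>\<pi>') = (\<integral>x. f x \<partial>\<mu>0)"
      by (simp add: continuous_on_compose2[OF f] continuous_on_fst LIMSEQ_const_iff)
    then show "(\<integral>x. f x \<partial>distr \<pi>' borel fst) = (\<integral>x. f x \<partial>\<mu>0)"
      by (subst integral_distr) auto
  qed (auto intro!: \<pi>'.prob_space_distr prob0)
  moreover have "distr \<pi>' borel snd = \<mu>1"
  proof (rule prob_measure_eqI_continuous)
    fix f :: "'b \<Rightarrow> real" assume f: "continuous_on UNIV f"
    note [measurable] = borel_measurable_continuous_onI[OF f]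
    have "(\<integral>z. f (snd z) \<partial>\<pi> n) = (\<integral>x. f x \<partial>\<mu>1)" for n
      unfolding coupling_snd[OF assms, of n, symmetric] by (subst integral_distr) auto
    with conv[of "\<lambda>z. f (snd z)"] have "(\<integral>z. f (snd z) \<partial>\<pi>') = (\<integral>x. f x \<partial>\<mu>1)"
      by (simp add: continuous_on_compose2[OF f] continuous_on_snd LIMSEQ_const_iff)
    then show "(\<integral>x. f x \<partial>distr \<pi>' borel snd) = (\<integral>x. f x \<partial>\<mu>1)"
      by (subst integral_distr) auto
  qed (auto intro!: \<pi>'.prob_space_distr prob1)
  ultimately have "\<pi>' \<in> couplings \<mu>0 \<mu>1" using \<pi>' by (simp add: couplings_def)
  then show thesis using r conv that by blast
qed

section \<open>Couplings with densities and approximation with finite entropy\<close>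

lemma density_in_couplings:
  assumes [measurable]: "D \<in> borel_measurable (\<mu>0 \<Otimes>\<^sub>M \<mu>1)"
    and "AE x in \<mu>0. (\<integral>\<^sup>+y. D (x, y) \<partial>\<mu>1) = 1" "AE y in \<mu>1. (\<integral>\<^sup>+x. D (x, y) \<partial>\<mu>0) = 1"
  shows "density (\<mu>0 \<Otimes>\<^sub>M \<mu>1) D \<in> couplings \<mu>0 \<mu>1"
proof -
  let ?\<pi> = "density (\<mu>0 \<Otimes>\<^sub>M \<mu>1) D"
  have "distr ?\<pi> borel fst = distr ?\<pi> \<mu>0 fst" "distr ?\<pi> borel snd = distr ?\<pi> \<mu>1 snd"
    by (intro distr_cong; simp)+
  moreover have "distr ?\<pi> \<mu>0 fst = \<mu>0" "distr ?\<pi> \<mu>1 snd = \<mu>1"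
    using assms \<mu>0.sigma_finite_measure_axioms \<mu>1.sigma_finite_measure_axioms
    by (auto intro!: distr_fst_density distr_snd_density)
  \<comment> \<open>Total mass one is inherited from the image measure
    \<open>\<mu>0\<close>.\<close>
  moreover from this(1) prob0 have "prob_space ?\<pi>"
    by (intro prob_space_distrD[of fst ?\<pi> \<mu>0]) auto
  ultimately show ?thesis by (simp add: couplings_def sets_product del: sets0 sets1)
qed

lemma product_in_couplings: "\<mu>0 \<Otimes>\<^sub>M \<mu>1 \<in> couplings \<mu>0 \<mu>1"
  using density_in_couplings[of "\<lambda>_. 1"] \<mu>0.emeasure_space_1 \<mu>1.emeasure_space_1
  by (simp add: density_1)

text \<open>
  The approximant is the coupling whose density with respect to the product is constant on the
  cells of a fine partition and which gives each cell the same mass as the original coupling. Where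
  a marginal cell is null, so is the cell of the coupling, and division by zero does no harm.
\<close>

lemma finite_KL_approximation:
  fixes f :: "'a \<times> 'b \<Rightarrow> real"
  assumes \<pi>: "\<pi> \<in> couplings \<mu>0 \<mu>1" and f: "continuous_on UNIV f" and "\<eta> > 0"
  obtains \<pi>' where "\<pi>' \<in> couplings \<mu>0 \<mu>1" "KL \<pi>' (\<mu>0 \<Otimes>\<^sub>M \<mu>1) \<noteq> \<infinity>"
    "\<bar>(\<integral>z. f z \<partial>\<pi>') - (\<integral>z. f z \<partial>\<pi>)\<bar> \<le> \<eta>"
proof -
  let ?Q = "\<mu>0 \<Otimes>\<^sub>M \<mu>1"
  \<comment> \<open>The oscillation bound \<open>\<eta> / 2\<close> is spent twice, once for each
    coupling, and the radius \<open>d / 2\<close> twice, once in each factor.\<close>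
  have "uniformly_continuous_on K f"
    using f compact_K by (intro compact_uniformly_continuous) (auto intro: continuous_on_subset)
  then obtain d where "d > 0" and
    d: "\<And>z w. z \<in> K \<Longrightarrow> w \<in> K \<Longrightarrow> dist w z < d \<Longrightarrow> dist (f w) (f z) < \<eta> / 2"
    using \<open>\<eta> > 0\<close> unfolding uniformly_continuous_on_def by (metis half_gt_zero)
  have "d / 2 > 0" using \<open>d > 0\<close> by simp
  obtain a :: "'a \<Rightarrow> nat" and c k where a[measurable]: "a \<in> measurable borel (count_space UNIV)"
    and a_le: "\<And>x. a x \<le> k" and c: "\<And>x. x \<in> cball 0 R \<Longrightarrow> c (a x) \<in> cball 0 R \<and> dist x (c (a x)) < d / 2"
    by (rule finite_quantizer[OF compact_cball \<open>d / 2 > 0\<close>, of 0 R]) (rule that; assumption)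
  obtain b :: "'b \<Rightarrow> nat" and e l where b[measurable]: "b \<in> measurable borel (count_space UNIV)"
    and b_le: "\<And>y. b y \<le> l" and e: "\<And>y. y \<in> cball 0 R \<Longrightarrow> e (b y) \<in> cball 0 R \<and> dist y (e (b y)) < d / 2"
    by (rule finite_quantizer[OF compact_cball \<open>d / 2 > 0\<close>, of 0 R]) (rule that; assumption)

  define p where "p i j = measure \<pi> {z. a (fst z) = i \<and> b (snd z) = j}" for i j
  define p0 where "p0 i = measure \<mu>0 {x. a x = i}" for i
  define p1 where "p1 j = measure \<mu>1 {y. b y = j}" for j
  define w where "w i j = p i j / (p0 i * p1 j)" for i j
  define D where "D z = w (a (fst z)) (b (snd z))" for z
  define \<pi>' where "\<pi>' = density ?Q D"

  interpret \<pi>: prob_space \<pi> by (rule coupling_prob[OF \<pi>])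
  note space[simp] = coupling_space[OF \<pi>]
  note [measurable] = coupling_measurable_fst[OF \<pi>] coupling_measurable_snd[OF \<pi>]
  have p0_eq: "p0 i = \<P>(z in \<pi>. a (fst z) = i)" for i
    unfolding p0_def coupling_fst[OF \<pi>, symmetric] by (subst measure_distr) (auto simp: vimage_def)
  have p1_eq: "p1 j = \<P>(z in \<pi>. b (snd z) = j)" for j
    unfolding p1_def coupling_snd[OF \<pi>, symmetric] by (subst measure_distr) (auto simp: vimage_def)
  have cells: "{z. a (fst z) = i \<and> b (snd z) = j} \<in> sets \<pi>"
    "{z. a (fst z) = i} \<in> sets \<pi>" "{z. b (snd z) = j} \<in> sets \<pi>" for i j
  proof -
    have "{z \<in> space \<pi>. a (fst z) = i \<and> b (snd z) = j} \<in> sets \<pi>"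
      "{z \<in> space \<pi>. a (fst z) = i} \<in> sets \<pi>" "{z \<in> space \<pi>. b (snd z) = j} \<in> sets \<pi>"
      by measurable
    then show "{z. a (fst z) = i \<and> b (snd z) = j} \<in> sets \<pi>"
      "{z. a (fst z) = i} \<in> sets \<pi>" "{z. b (snd z) = j} \<in> sets \<pi>" by auto
  qed
  have p_sum0: "p0 i = (\<Sum>j\<le>l. p i j)" for i
  proof -
    have "p0 i = (\<Sum>j\<le>l. \<P>(z in \<pi>. a (fst z) = i \<and> b (snd z) = j))"
      unfolding p0_eq by (rule \<pi>.prob_sum) (use b_le cells in auto)
    then show ?thesis by (simp add: p_def)
  qed
  have p_sum1: "p1 j = (\<Sum>i\<le>k. p i j)" for j
  proof -
    have "p1 j = (\<Sum>i\<le>k. \<P>(z in \<pi>. a (fst z) = i \<and> b (snd z) = j))"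
      unfolding p1_eq by (rule \<pi>.prob_sum) (use a_le cells in auto)
    then show ?thesis by (simp add: p_def)
  qed
  have p_nonneg: "0 \<le> p i j" "0 \<le> p0 i" "0 \<le> p1 j" for i j
    by (auto simp: p_def p0_def p1_def)
  have p_le: "p i j \<le> p0 i" "p i j \<le> p1 j" for i j
    unfolding p0_eq p1_eq by (auto simp: p_def intro!: \<pi>.finite_measure_mono cells)
  have p_zero: "p i j = 0" if "p0 i = 0 \<or> p1 j = 0" for i j
    using that p_le[of i j] p_nonneg(1)[of i j] by auto
  have w_p: "w i j * (p0 i * p1 j) = p i j" for i j
    using p_zero[of i j] by (cases "p0 i * p1 j = 0") (auto simp: w_def)
  have w_nonneg: "0 \<le> w i j" for i j
    using p_nonneg by (simp add: w_def)

  have [measurable]: "D \<in> borel_measurable ?Q"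
    unfolding D_def by measurable
  have D_bound: "0 \<le> D z" "D z \<le> (\<Sum>i\<le>k. \<Sum>j\<le>l. w i j)" for z
  proof -
    show "0 \<le> D z" by (simp add: D_def w_nonneg)
    have "D z \<le> (\<Sum>j\<le>l. w (a (fst z)) j)"
      unfolding D_def by (rule member_le_sum) (auto simp: b_le w_nonneg)
    also have "\<dots> \<le> (\<Sum>i\<le>k. \<Sum>j\<le>l. w i j)"
      by (rule member_le_sum[where f = "\<lambda>i. \<Sum>j\<le>l. w i j"]) (auto simp: a_le w_nonneg intro!: sum_nonneg)
    finally show "D z \<le> (\<Sum>i\<le>k. \<Sum>j\<le>l. w i j)" .
  qed

  \<comment> \<open>The null cells together form a null set, so division by \<open>p0\<close> is
    legitimate on almost every fibre.\<close>
  have "AE x in \<mu>0. p0 (a x) \<noteq> 0"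
  proof -
    have "AE x in \<mu>0. \<forall>i. a x = i \<longrightarrow> p0 i \<noteq> 0"
      unfolding AE_all_countable
    proof
      fix i
      show "AE x in \<mu>0. a x = i \<longrightarrow> p0 i \<noteq> 0"
      proof (cases "p0 i = 0")
        case True
        then have "{x. a x = i} \<in> null_sets \<mu>0"
          by (auto simp: p0_def null_sets_def \<mu>0.emeasure_eq_measure)
        from AE_not_in[OF this] show ?thesis by eventually_elim simp
      qed simp
    qed
    then show ?thesis by eventually_elim simp
  qed
  then have marg0: "AE x in \<mu>0. (\<integral>\<^sup>+y. D (x, y) \<partial>\<mu>1) = 1"
  proof eventually_elim
    case (elim x)
    have "(\<integral>\<^sup>+y. D (x, y) \<partial>\<mu>1) = ennreal (\<integral>y. w (a x) (b y) \<partial>\<mu>1)"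
      unfolding D_def fst_conv snd_conv
      by (intro nn_integral_eq_integral integrable_finite_range[OF prob1, of b "{..l}"])
         (auto simp: b_le w_nonneg)
    also have "(\<integral>y. w (a x) (b y) \<partial>\<mu>1) = (\<Sum>j\<le>l. w (a x) j * p1 j)"
      unfolding p1_def by (subst integral_finite_range[OF prob1, of b "{..l}"]) (auto simp: b_le)
    also have "\<dots> = (\<Sum>j\<le>l. p (a x) j / p0 (a x))"
      using elim w_p[of "a x"] by (intro sum.cong refl) (simp add: field_simps)
    also have "\<dots> = 1"
      using elim by (simp add: sum_divide_distrib[symmetric] p_sum0[symmetric])
    finally show ?case by simp
  qed
  have "AE y in \<mu>1. p1 (b y) \<noteq> 0"
  proof -
    have "AE y in \<mu>1. \<forall>j. b y = j \<longrightarrow> p1 j \<noteq> 0"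
      unfolding AE_all_countable
    proof
      fix j
      show "AE y in \<mu>1. b y = j \<longrightarrow> p1 j \<noteq> 0"
      proof (cases "p1 j = 0")
        case True
        then have "{y. b y = j} \<in> null_sets \<mu>1"
          by (auto simp: p1_def null_sets_def \<mu>1.emeasure_eq_measure)
        from AE_not_in[OF this] show ?thesis by eventually_elim simp
      qed simp
    qed
    then show ?thesis by eventually_elim simp
  qed
  then have marg1: "AE y in \<mu>1. (\<integral>\<^sup>+x. D (x, y) \<partial>\<mu>0) = 1"
  proof eventually_elim
    case (elim y)
    have "(\<integral>\<^sup>+x. D (x, y) \<partial>\<mu>0) = ennreal (\<integral>x. w (a x) (b y) \<partial>\<mu>0)"
      unfolding D_def fst_conv snd_conv
      by (intro nn_integral_eq_integral integrable_finite_range[OF prob0, of a "{..k}" "\<lambda>i. w i (b y)"])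
         (auto simp: a_le w_nonneg)
    also have "(\<integral>x. w (a x) (b y) \<partial>\<mu>0) = (\<Sum>i\<le>k. w i (b y) * p0 i)"
      unfolding p0_def
      by (subst integral_finite_range[OF prob0, of a "{..k}" "\<lambda>i. w i (b y)"]) (auto simp: a_le)
    also have "\<dots> = (\<Sum>i\<le>k. p i (b y) / p1 (b y))"
      using elim w_p[of _ "b y"] by (intro sum.cong refl) (simp add: field_simps)
    also have "\<dots> = 1"
      using elim by (simp add: sum_divide_distrib[symmetric] p_sum1[symmetric])
    finally show ?case by simp
  qed
  have \<pi>': "\<pi>' \<in> couplings \<mu>0 \<mu>1"
    unfolding \<pi>'_def using marg0 marg1 by (intro density_in_couplings) auto
  have KL: "KL \<pi>' ?Q \<noteq> \<infinity>"
    unfolding \<pi>'_def by (rule KL_density_finite[OF P.prob_space_axioms _ D_bound]) simp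

  \<comment> \<open>\<open>f\<close> sampled at the cell centres. Both couplings give this step
    function the same integral, since they agree on the mass of every cell.\<close>
  define s where "s i j = f (c i, e j)" for i j
  let ?q = "\<lambda>z. (a (fst z), b (snd z))" and ?J = "{..k} \<times> {..l}"
  have J: "finite ?J" "\<And>z. ?q z \<in> ?J" by (auto simp: a_le b_le)
  have Q_cell: "measure ?Q {z \<in> space ?Q. ?q z = (i, j)} = p0 i * p1 j" for i j
  proof -
    have "{z \<in> space ?Q. ?q z = (i, j)} = {x. a x = i} \<times> {y. b y = j}"
      by (auto simp: space_pair_measure)
    then show ?thesis
      by (simp add: measure_def \<mu>1.emeasure_pair_measure_Times enn2real_mult p0_def p1_def)
  qed
  have "(\<integral>z. s (a (fst z)) (b (snd z)) \<partial>\<pi>') = (\<integral>z. D z * s (a (fst z)) (b (snd z)) \<partial>?Q)"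
    unfolding \<pi>'_def by (subst integral_real_density) (auto simp: D_bound)
  also have "\<dots> = (\<integral>z. case_prod (\<lambda>i j. w i j * s i j) (?q z) \<partial>?Q)"
    by (simp add: D_def)
  also have "\<dots> = (\<Sum>(i, j)\<in>?J. w i j * s i j * (p0 i * p1 j))"
    by (subst integral_finite_range[OF P.prob_space_axioms _ J])
       (auto simp only: Q_cell split_beta prod.collapse intro!: sum.cong, measurable)
  also have "\<dots> = (\<Sum>(i, j)\<in>?J. s i j * p i j)"
    using w_p by (intro sum.cong refl) (auto simp: algebra_simps)
  also have "\<dots> = (\<integral>z. case_prod s (?q z) \<partial>\<pi>)"
    by (subst integral_finite_range[OF \<pi>.prob_space_axioms _ J]) (auto simp: p_def intro!: sum.cong)
  finally have eq: "(\<integral>z. s (a (fst z)) (b (snd z)) \<partial>\<pi>') = (\<integral>z. s (a (fst z)) (b (snd z)) \<partial>\<pi>)"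
    by simp

  \<comment> \<open>Every coupling lives on \<open>K\<close>, where \<open>f\<close> is uniformly
    close to its step function.\<close>
  have close: "\<bar>(\<integral>z. f z \<partial>\<rho>) - (\<integral>z. s (a (fst z)) (b (snd z)) \<partial>\<rho>)\<bar> \<le> \<eta> / 2"
    if \<rho>: "\<rho> \<in> couplings \<mu>0 \<mu>1" for \<rho>
  proof -
    interpret \<rho>: prob_space \<rho> by (rule coupling_prob[OF \<rho>])
    note [measurable] = coupling_measurable_fst[OF \<rho>] coupling_measurable_snd[OF \<rho>]
    have int: "integrable \<rho> f" by (rule coupling_integrable[OF \<rho> f])
    have "integrable \<rho> (\<lambda>z. case_prod s (?q z))"
      by (rule integrable_finite_range[OF \<rho>.prob_space_axioms _ J]) measurable
    then have int_s: "integrable \<rho> (\<lambda>z. s (a (fst z)) (b (snd z)))" by simp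
    have AE: "AE z in \<rho>. \<bar>f z - s (a (fst z)) (b (snd z))\<bar> \<le> \<eta> / 2"
      using coupling_AE[OF \<rho>]
    proof eventually_elim
      case (elim z)
      obtain x y where z: "z = (x, y)" by (cases z)
      with elim have "x \<in> cball 0 R" "y \<in> cball 0 R" by (auto simp: K_def)
      note xy = c[OF this(1)] e[OF this(2)]
      have "dist z (c (a x), e (b y)) \<le> dist x (c (a x)) + dist y (e (b y))"
        unfolding z dist_Pair_Pair by (rule sqrt_sum_squares_le_sum) auto
      also have "\<dots> < d" using xy by linarith
      finally have "dist (f z) (f (c (a x), e (b y))) < \<eta> / 2"
        using elim xy by (intro d) (auto simp: K_def)
      then show ?case by (simp add: z s_def dist_real_def)
    qed
    have "\<bar>\<integral>z. f z - s (a (fst z)) (b (snd z)) \<partial>\<rho>\<bar> \<le> (\<integral>z. \<bar>f z - s (a (fst z)) (b (snd z))\<bar> \<partial>\<rho>)"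
      by (rule integral_abs_bound)
    also have "\<dots> \<le> \<eta> / 2"
      using int int_s AE by (intro \<rho>.integral_le_const integrable_abs Bochner_Integration.integrable_diff) auto
    finally show ?thesis using int int_s by simp
  qed
  have "\<bar>(\<integral>z. f z \<partial>\<pi>') - (\<integral>z. f z \<partial>\<pi>)\<bar> \<le> \<eta>"
    using close[OF \<pi>'] close[OF \<pi>] eq by linarith
  from that[OF \<pi>' KL this] show thesis .
qed

end

section \<open>Stability of the variational problem\<close>

text \<open>The bilinear term of the cost is a Frobenius pairing with \<open>A\<close>. Hence the
  cost is affine in \<open>A\<close>, and its integral depends on \<open>A\<close> only through the
  cross moment.\<close>

lemma inner_outer_prod: "A \<bullet> outer_prod x y = x \<bullet> (A *v y)"
  by (simp add: inner_vec_def outer_prod_def matrix_vector_mult_def sum_distrib_left mult_ac)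

text \<open>Pair the rank-one matrix with itself and use that it maps \<open>y\<close> to
  \<open>(y \<bullet> y) *\<^sub>R x\<close>.\<close>

lemma norm_outer_prod: "norm (outer_prod x y) = norm x * norm y"
proof -
  have "outer_prod x y *v y = (y \<bullet> y) *\<^sub>R x"
    by (simp add: vec_eq_iff outer_prod_def matrix_vector_mult_def inner_vec_def
        sum_distrib_left sum_distrib_right mult_ac)
  then show ?thesis
    by (simp add: norm_eq_sqrt_inner inner_outer_prod real_sqrt_mult mult.commute)
qed

lemma continuous_on_outer_prod: "continuous_on S (\<lambda>z. outer_prod (fst z) (snd z))"
  unfolding outer_prod_def by (intro continuous_intros)

lemma cost_eq: "cost A z = cost 0 z - 32 * (A \<bullet> outer_prod (fst z) (snd z))"
  by (cases z) (simp add: cost_def inner_outer_prod)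

lemma continuous_on_cost: "continuous_on S (cost A)"
proof -
  have "cost A = (\<lambda>z. - 4 * (norm (fst z))\<^sup>2 * (norm (snd z))\<^sup>2
      - 32 * (A \<bullet> outer_prod (fst z) (snd z)))"
    by (auto simp: cost_def inner_outer_prod)
  then show ?thesis
    by (simp only:) (intro continuous_intros continuous_on_outer_prod)
qed

locale bounded_OT = bounded_marginals \<mu>0 \<mu>1 R
  for \<mu>0 :: "(real ^ 'm) measure" and \<mu>1 :: "(real ^ 'n) measure" and R
begin

text \<open>The part of the objective without \<open>A\<close>: one coupling has the same penalty
  for all matrices.\<close>

definition penalty :: "real \<Rightarrow> ((real ^ 'm) \<times> (real ^ 'n)) measure \<Rightarrow> ereal" where
  "penalty \<epsilon> \<pi> = (if \<epsilon> = 0 then 0 else ereal \<epsilon> * KL \<pi> (\<mu>0 \<Otimes>\<^sub>M \<mu>1))"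

lemma OT_objective_eq: "OT_objective \<mu>0 \<mu>1 A \<epsilon> \<pi> = ereal (\<integral>z. cost A z \<partial>\<pi>) + penalty \<epsilon> \<pi>"
  by (simp add: OT_objective_def penalty_def)

definition val :: "real ^ 'n ^ 'm \<Rightarrow> real \<Rightarrow> real" where
  "val A \<epsilon> = real_of_ereal (OT \<mu>0 \<mu>1 A \<epsilon>)"

lemma Phi_eq: "Phi \<mu>0 \<mu>1 \<epsilon> A = 32 * (norm A)\<^sup>2 + val A \<epsilon>"
  by (simp add: Phi_def val_def)

context
  fixes \<pi> assumes \<pi>: "\<pi> \<in> couplings \<mu>0 \<mu>1"
begin

lemma inner_cross_moment: "A \<bullet> cross_moment \<pi> = (\<integral>z. A \<bullet> outer_prod (fst z) (snd z) \<partial>\<pi>)"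
  using coupling_integrable[OF \<pi> continuous_on_outer_prod]
  by (simp add: cross_moment_def case_prod_unfold)

lemma integral_cost: "(\<integral>z. cost A z \<partial>\<pi>) = (\<integral>z. cost 0 z \<partial>\<pi>) - 32 * (A \<bullet> cross_moment \<pi>)"
proof -
  have "integrable \<pi> (cost 0)" "integrable \<pi> (\<lambda>z. A \<bullet> outer_prod (fst z) (snd z))"
    by (intro coupling_integrable[OF \<pi>] continuous_on_cost continuous_intros continuous_on_outer_prod)+
  then show ?thesis
    unfolding inner_cross_moment cost_eq[of A] by simp
qed

lemma integral_cost_diff:
  "(\<integral>z. cost A z \<partial>\<pi>) = (\<integral>z. cost B z \<partial>\<pi>) - 32 * ((A - B) \<bullet> cross_moment \<pi>)"
  by (simp add: integral_cost[of A] integral_cost[of B] inner_diff_left)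

lemma norm_cross_moment: "norm (cross_moment \<pi>) \<le> R\<^sup>2"
proof -
  have "norm (outer_prod (fst z) (snd z)) \<le> R\<^sup>2" if "z \<in> K" for z
    using that mult_mono[of "norm (fst z)" R "norm (snd z)" R]
    by (cases z) (auto simp: K_def norm_outer_prod power2_eq_square intro: order_trans[OF norm_ge_zero])
  then show ?thesis
    unfolding cross_moment_def case_prod_unfold
    by (intro coupling_integral_bound[OF \<pi>] continuous_on_outer_prod)
qed

lemma penalty_nonneg:
  assumes "\<epsilon> \<ge> 0" shows "0 \<le> penalty \<epsilon> \<pi>"
proof -
  have "0 \<le> KL \<pi> (\<mu>0 \<Otimes>\<^sub>M \<mu>1)"
    using coupling_sets[OF \<pi>] sets_product
    by (intro KL_nonneg coupling_prob[OF \<pi>] P.prob_space_axioms) simp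
  then show ?thesis using assms by (simp add: penalty_def)
qed

lemma penalty_finite:
  assumes "\<epsilon> \<ge> 0" "KL \<pi> (\<mu>0 \<Otimes>\<^sub>M \<mu>1) \<noteq> \<infinity>"
  obtains k where "KL \<pi> (\<mu>0 \<Otimes>\<^sub>M \<mu>1) = ereal k" "penalty \<epsilon> \<pi> = ereal (\<epsilon> * k)"
proof -
  have "0 \<le> KL \<pi> (\<mu>0 \<Otimes>\<^sub>M \<mu>1)"
    \<comment> \<open>At \<open>\<epsilon> = 1\<close> the penalty is the divergence itself.\<close>
    using penalty_nonneg[of 1] by (simp add: penalty_def)
  with assms obtain k where "KL \<pi> (\<mu>0 \<Otimes>\<^sub>M \<mu>1) = ereal k"
    by (cases "KL \<pi> (\<mu>0 \<Otimes>\<^sub>M \<mu>1)") auto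
  then show thesis by (intro that[of k]) (auto simp: penalty_def)
qed

end

text \<open>Approximating the zero function already produces such a coupling, without computing the
  entropy of the product.\<close>

lemma exists_finite_KL_coupling: "\<exists>\<pi>\<in>couplings \<mu>0 \<mu>1. KL \<pi> (\<mu>0 \<Otimes>\<^sub>M \<mu>1) \<noteq> \<infinity>"
  by (rule finite_KL_approximation[OF product_in_couplings continuous_on_const[of _ 0] zero_less_one]) blast

text \<open>The infimum is bounded below since the cost is bounded on \<open>K\<close> and the
  penalty nonnegative, and above by a coupling of finite entropy.\<close>

lemma OT_eq_val:
  assumes "\<epsilon> \<ge> 0" shows "OT \<mu>0 \<mu>1 A \<epsilon> = ereal (val A \<epsilon>)"
proof -
  have "bounded (cost A ` K)"
    by (intro compact_imp_bounded compact_continuous_image continuous_on_cost compact_K)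
  then obtain C where C: "\<And>z. z \<in> K \<Longrightarrow> norm (cost A z) \<le> C" by (auto simp: bounded_iff)
  have "ereal (- C) \<le> OT \<mu>0 \<mu>1 A \<epsilon>"
    unfolding OT_def
  proof (rule INF_greatest)
    fix \<pi> assume \<pi>: "\<pi> \<in> couplings \<mu>0 \<mu>1"
    have "- C \<le> (\<integral>z. cost A z \<partial>\<pi>)"
      using coupling_integral_bound[OF \<pi> continuous_on_cost C] by (simp add: abs_le_iff)
    then have "ereal (- C) + 0 \<le> ereal (\<integral>z. cost A z \<partial>\<pi>) + penalty \<epsilon> \<pi>"
      using penalty_nonneg[OF \<pi> assms] by (intro add_mono) auto
    then show "ereal (- C) \<le> OT_objective \<mu>0 \<mu>1 A \<epsilon> \<pi>" by (simp add: OT_objective_eq)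
  qed
  moreover obtain \<pi> where \<pi>: "\<pi> \<in> couplings \<mu>0 \<mu>1" "KL \<pi> (\<mu>0 \<Otimes>\<^sub>M \<mu>1) \<noteq> \<infinity>"
    using exists_finite_KL_coupling by blast
  moreover have "OT \<mu>0 \<mu>1 A \<epsilon> \<le> OT_objective \<mu>0 \<mu>1 A \<epsilon> \<pi>"
    unfolding OT_def by (rule INF_lower) (rule \<pi>)
  moreover obtain k where "penalty \<epsilon> \<pi> = ereal (\<epsilon> * k)"
    using penalty_finite[OF \<pi>(1) assms \<pi>(2)] by metis
  ultimately show ?thesis
    by (cases "OT \<mu>0 \<mu>1 A \<epsilon>") (auto simp: val_def OT_objective_eq)
qed

lemma val_le:
  assumes \<pi>: "\<pi> \<in> couplings \<mu>0 \<mu>1" and "\<epsilon> \<ge> 0" and "penalty \<epsilon> \<pi> = ereal \<kappa>"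
  shows "val A \<epsilon> \<le> (\<integral>z. cost A z \<partial>\<pi>) + \<kappa>"
proof -
  have "OT \<mu>0 \<mu>1 A \<epsilon> \<le> OT_objective \<mu>0 \<mu>1 A \<epsilon> \<pi>"
    unfolding OT_def by (rule INF_lower) (rule \<pi>)
  then show ?thesis using assms by (simp add: OT_eq_val OT_objective_eq)
qed

lemma val_zero_le: "\<pi> \<in> couplings \<mu>0 \<mu>1 \<Longrightarrow> val A 0 \<le> (\<integral>z. cost A z \<partial>\<pi>)"
  using val_le[of \<pi> 0 0 A] by (simp add: penalty_def)

text \<open>A coupling that is optimal up to \<open>\<eta>\<close> for \<open>A\<close> competes for
  every \<open>B\<close> with the same penalty, which gives an affine majorant of the value.\<close>

lemma near_optimal_coupling:
  assumes "\<epsilon> \<ge> 0" "\<eta> > 0"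
  obtains \<pi> where "\<pi> \<in> couplings \<mu>0 \<mu>1" "(\<integral>z. cost A z \<partial>\<pi>) \<le> val A \<epsilon> + \<eta>"
    "\<And>B. val B \<epsilon> \<le> val A \<epsilon> + \<eta> - 32 * ((B - A) \<bullet> cross_moment \<pi>)"
proof -
  have "OT \<mu>0 \<mu>1 A \<epsilon> < ereal (val A \<epsilon> + \<eta>)" using assms by (simp add: OT_eq_val)
  then obtain \<pi> where \<pi>: "\<pi> \<in> couplings \<mu>0 \<mu>1"
    and less: "ereal (\<integral>z. cost A z \<partial>\<pi>) + penalty \<epsilon> \<pi> < ereal (val A \<epsilon> + \<eta>)"
    unfolding OT_def INF_less_iff OT_objective_eq by blast
  have "0 \<le> penalty \<epsilon> \<pi>" by (rule penalty_nonneg[OF \<pi> assms(1)])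
  with less obtain \<kappa> where \<kappa>: "penalty \<epsilon> \<pi> = ereal \<kappa>" "0 \<le> \<kappa>"
    by (cases "penalty \<epsilon> \<pi>") auto
  with less have le: "(\<integral>z. cost A z \<partial>\<pi>) + \<kappa> \<le> val A \<epsilon> + \<eta>" by simp
  show thesis
  proof (rule that[OF \<pi>])
    show "(\<integral>z. cost A z \<partial>\<pi>) \<le> val A \<epsilon> + \<eta>" using le \<kappa>(2) by simp
    show "val B \<epsilon> \<le> val A \<epsilon> + \<eta> - 32 * ((B - A) \<bullet> cross_moment \<pi>)" for B
      using val_le[OF \<pi> assms(1) \<kappa>(1), of B] integral_cost_diff[OF \<pi>, of B A] le by simp
  qed
qed

lemma val_mono:
  assumes "\<epsilon> \<ge> 0" shows "val A 0 \<le> val A \<epsilon>"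
proof (rule field_le_epsilon)
  fix \<eta> :: real assume "\<eta> > 0"
  then obtain \<pi> where "\<pi> \<in> couplings \<mu>0 \<mu>1" "(\<integral>z. cost A z \<partial>\<pi>) \<le> val A \<epsilon> + \<eta>"
    using near_optimal_coupling[OF assms] by metis
  then show "val A 0 \<le> val A \<epsilon> + \<eta>"
    using val_zero_le by (meson order_trans)
qed

text \<open>The slopes of the affine majorants are bounded by \<open>32 * R\<^sup>2\<close>, the
  bound on the cross moment times 32.\<close>

lemma val_lipschitz:
  assumes "\<epsilon> \<ge> 0" shows "val B \<epsilon> \<le> val A \<epsilon> + 32 * R\<^sup>2 * norm (B - A)"
proof (rule field_le_epsilon)
  fix \<eta> :: real assume "\<eta> > 0"
  then obtain \<pi> where \<pi>: "\<pi> \<in> couplings \<mu>0 \<mu>1"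
    and le: "val B \<epsilon> \<le> val A \<epsilon> + \<eta> - 32 * ((B - A) \<bullet> cross_moment \<pi>)"
    using near_optimal_coupling[OF assms] by metis
  have "- ((B - A) \<bullet> cross_moment \<pi>) \<le> norm (B - A) * norm (cross_moment \<pi>)"
    using Cauchy_Schwarz_ineq2[of "B - A" "cross_moment \<pi>"] by linarith
  also have "\<dots> \<le> norm (B - A) * R\<^sup>2"
    by (intro mult_left_mono norm_cross_moment[OF \<pi>]) simp
  finally show "val B \<epsilon> \<le> val A \<epsilon> + 32 * R\<^sup>2 * norm (B - A) + \<eta>"
    using le by (simp add: mult.commute)
qed

text \<open>One fixed competitor of finite divergence \<open>k\<close> serves all \<open>n\<close>,
  and its penalty \<open>e n * k\<close> vanishes. Near-optimality and approximation cost
  \<open>\<eta> / 3\<close> each; the last third makes the inequality strict.\<close>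

lemma val_limsup:
  assumes e: "e \<longlonglongrightarrow> 0" "\<And>n. e n \<ge> 0" and A: "A \<longlonglongrightarrow> B" and "\<eta> > 0"
  shows "\<forall>\<^sub>F n in sequentially. val (A n) (e n) < val B 0 + \<eta>"
proof -
  have "\<eta> / 3 > 0" using \<open>\<eta> > 0\<close> by simp
  then obtain \<pi> where \<pi>: "\<pi> \<in> couplings \<mu>0 \<mu>1" "(\<integral>z. cost B z \<partial>\<pi>) \<le> val B 0 + \<eta> / 3"
    using near_optimal_coupling[of 0] by (metis order_refl)
  obtain \<pi>' where \<pi>': "\<pi>' \<in> couplings \<mu>0 \<mu>1" "KL \<pi>' (\<mu>0 \<Otimes>\<^sub>M \<mu>1) \<noteq> \<infinity>"
    and close: "\<bar>(\<integral>z. cost B z \<partial>\<pi>') - (\<integral>z. cost B z \<partial>\<pi>)\<bar> \<le> \<eta> / 3"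
    by (rule finite_KL_approximation[OF \<pi>(1) continuous_on_cost \<open>\<eta> / 3 > 0\<close>])
  obtain k where k: "KL \<pi>' (\<mu>0 \<Otimes>\<^sub>M \<mu>1) = ereal k"
    using penalty_finite[OF \<pi>'(1) order_refl \<pi>'(2)] by metis
  have pen: "penalty (e n) \<pi>' = ereal (e n * k)" for n
    by (simp add: penalty_def k)
  have le: "val (A n) (e n) \<le> (\<integral>z. cost B z \<partial>\<pi>') - 32 * ((A n - B) \<bullet> cross_moment \<pi>') + e n * k" for n
    using val_le[OF \<pi>'(1) e(2) pen, of "A n"] integral_cost_diff[OF \<pi>'(1), of "A n" B] by simp
  have "(\<lambda>n. (\<integral>z. cost B z \<partial>\<pi>') - 32 * ((A n - B) \<bullet> cross_moment \<pi>') + e n * k) \<longlonglongrightarrow>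
      (\<integral>z. cost B z \<partial>\<pi>') - 32 * ((B - B) \<bullet> cross_moment \<pi>') + 0 * k"
    by (intro tendsto_intros e A)
  moreover have "(\<integral>z. cost B z \<partial>\<pi>') - 32 * ((B - B) \<bullet> cross_moment \<pi>') + 0 * k < val B 0 + \<eta>"
    using \<pi>(2) close \<open>\<eta> > 0\<close> unfolding abs_le_iff by simp
  ultimately have "\<forall>\<^sub>F n in sequentially.
      (\<integral>z. cost B z \<partial>\<pi>') - 32 * ((A n - B) \<bullet> cross_moment \<pi>') + e n * k < val B 0 + \<eta>"
    by (rule order_tendstoD(2))
  then show ?thesis by eventually_elim (use le in \<open>auto intro: le_less_trans\<close>)
qed

text \<open>
  This replaces the exact gradient formula, so that no entropic minimizer is needed: the
  objective of a nearly optimal coupling touches \<open>\<Phi>\<^sub>\<epsilon>\<close> from above up to an error that is small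
  compared with the step length \<open>t\<close>.
\<close>

lemma near_optimal_coupling_gradient:
  assumes "\<epsilon> \<ge> 0" and G: "GDERIV (Phi \<mu>0 \<mu>1 \<epsilon>) A :> G" and "\<eta> > 0"
  obtains \<pi> where "\<pi> \<in> couplings \<mu>0 \<mu>1" "(\<integral>z. cost A z \<partial>\<pi>) \<le> val A \<epsilon> + \<eta>"
    "norm (64 *\<^sub>R A - 32 *\<^sub>R cross_moment \<pi>) \<le> norm G + \<eta>"
proof -
  have "\<eta> / 4 > 0" using \<open>\<eta> > 0\<close> by simp
  with G obtain d where "d > 0" and d: "\<And>B. norm (B - A) < d \<Longrightarrow>
      norm (Phi \<mu>0 \<mu>1 \<epsilon> B - Phi \<mu>0 \<mu>1 \<epsilon> A - (B - A) \<bullet> G) \<le> \<eta> / 4 * norm (B - A)"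
    unfolding gderiv_def has_derivative_at_alt by metis
  \<comment> \<open>The step stays within the differentiability radius and is so short that the
    quadratic term of \<open>Phi\<close>, \<open>32 * t\<^sup>2\<close>, is at most
    \<open>\<eta> / 4 * t\<close>.\<close>
  define t where "t = min (d / 2) (\<eta> / 128)"
  have t: "t > 0" "t < d" "32 * t \<le> \<eta> / 4"
    using \<open>d > 0\<close> \<open>\<eta> > 0\<close> by (auto simp: t_def min_def)
  \<comment> \<open>The slack must be small relative to \<open>t\<close>, since the comparison is
    divided by \<open>t\<close> at the end.\<close>
  have "min \<eta> (\<eta> / 4 * t) > 0" using t \<open>\<eta> > 0\<close> by simp
  then obtain \<pi> where \<pi>: "\<pi> \<in> couplings \<mu>0 \<mu>1"
    and cost: "(\<integral>z. cost A z \<partial>\<pi>) \<le> val A \<epsilon> + min \<eta> (\<eta> / 4 * t)"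
    and upper: "\<And>B. val B \<epsilon> \<le> val A \<epsilon> + min \<eta> (\<eta> / 4 * t) - 32 * ((B - A) \<bullet> cross_moment \<pi>)"
    using near_optimal_coupling[OF assms(1)] by metis
  define G' where "G' = 64 *\<^sub>R A - 32 *\<^sub>R cross_moment \<pi>"
  have "norm (G - G') \<le> \<eta>"
  proof (cases "G = G'")
    case False
    \<comment> \<open>A step of length \<open>t\<close> along \<open>G - G'\<close>, so that the
      comparison yields the norm of this difference.\<close>
    define h where "h = (t / norm (G - G')) *\<^sub>R (G - G')"
    have norm_h: "norm h = t" using False t by (simp add: h_def)
    have "h \<bullet> (G - G') = t * norm (G - G')"
      using False by (simp add: h_def power2_norm_eq_inner[symmetric] power2_eq_square)
    moreover
    have "\<bar>Phi \<mu>0 \<mu>1 \<epsilon> (A + h) - Phi \<mu>0 \<mu>1 \<epsilon> A - h \<bullet> G\<bar> \<le> \<eta> / 4 * t"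
      using d[of "A + h"] norm_h t by simp
    then have "h \<bullet> G - \<eta> / 4 * t \<le> Phi \<mu>0 \<mu>1 \<epsilon> (A + h) - Phi \<mu>0 \<mu>1 \<epsilon> A"
      by linarith
    moreover have "(norm (A + h))\<^sup>2 = (norm A)\<^sup>2 + 2 * (h \<bullet> A) + t\<^sup>2"
      unfolding norm_h[symmetric] power2_norm_eq_inner
      by (simp add: inner_add_left inner_add_right inner_commute)
    moreover have "h \<bullet> G' = 64 * (h \<bullet> A) - 32 * (h \<bullet> cross_moment \<pi>)"
      by (simp add: G'_def inner_diff_right)
    moreover have "32 * t\<^sup>2 \<le> \<eta> / 4 * t"
      using mult_right_mono[OF t(3), of t] t(1) by (simp add: power2_eq_square)
    moreover have "val (A + h) \<epsilon> \<le> val A \<epsilon> + \<eta> / 4 * t - 32 * (h \<bullet> cross_moment \<pi>)"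
      using upper[of "A + h"] by simp
    \<comment> \<open>Three errors of at most \<open>\<eta> / 4 * t\<close>: differentiation, the
      quadratic term, and near-optimality.\<close>
    ultimately have "t * norm (G - G') \<le> 3 * (\<eta> / 4 * t)"
      unfolding Phi_eq inner_diff_right by argo
    then have "t * norm (G - G') \<le> t * \<eta>"
      using t \<open>\<eta> > 0\<close> by (simp add: algebra_simps)
    then show ?thesis using t by simp
  qed (use \<open>\<eta> > 0\<close> in simp)
  then have "norm G' \<le> norm G + \<eta>"
    using norm_triangle_ineq3[of G' G] by (simp add: norm_minus_commute)
  with \<pi> cost that show thesis unfolding G'_def by (simp add: min_le_iff_disj)
qed

text \<open>Couplings that are optimal and stationary up to \<open>e n\<close> have a weak limit
  point; optimality and the gradient bound both pass to it.\<close>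

lemma limit_stationary:
  assumes e: "\<And>n. e n > 0" "e \<longlonglongrightarrow> 0" and A: "(\<lambda>n. A (e n)) \<longlonglongrightarrow> A0"
    and grad: "\<And>n. \<exists>G. GDERIV (Phi \<mu>0 \<mu>1 (e n)) (A (e n)) :> G \<and> norm G \<le> \<delta>"
  shows "\<exists>\<pi>. OT_solution \<mu>0 \<mu>1 A0 0 \<pi> \<and> norm (64 *\<^sub>R A0 - 32 *\<^sub>R cross_moment \<pi>) \<le> \<delta>"
proof -
  have "\<exists>\<pi>\<in>couplings \<mu>0 \<mu>1. (\<integral>z. cost (A (e n)) z \<partial>\<pi>) \<le> val (A (e n)) (e n) + e n \<and>
      norm (64 *\<^sub>R A (e n) - 32 *\<^sub>R cross_moment \<pi>) \<le> \<delta> + e n" for n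
  proof -
    obtain G where G: "GDERIV (Phi \<mu>0 \<mu>1 (e n)) (A (e n)) :> G" "norm G \<le> \<delta>"
      using grad by blast
    obtain \<pi> where "\<pi> \<in> couplings \<mu>0 \<mu>1"
      "(\<integral>z. cost (A (e n)) z \<partial>\<pi>) \<le> val (A (e n)) (e n) + e n"
      "norm (64 *\<^sub>R A (e n) - 32 *\<^sub>R cross_moment \<pi>) \<le> norm G + e n"
      by (rule near_optimal_coupling_gradient[OF less_imp_le[OF e(1)] G(1) e(1)])
    with G(2) show ?thesis by (intro bexI[of _ \<pi>]) auto
  qed
  then obtain \<pi> where \<pi>: "\<And>n. \<pi> n \<in> couplings \<mu>0 \<mu>1"
    and cost: "\<And>n. (\<integral>z. cost (A (e n)) z \<partial>\<pi> n) \<le> val (A (e n)) (e n) + e n"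
    and near: "\<And>n. norm (64 *\<^sub>R A (e n) - 32 *\<^sub>R cross_moment (\<pi> n)) \<le> \<delta> + e n"
    by metis
  obtain r \<pi>' where r: "strict_mono (r :: nat \<Rightarrow> nat)" and \<pi>': "\<pi>' \<in> couplings \<mu>0 \<mu>1"
    and conv: "\<And>f :: (real ^ 'm) \<times> (real ^ 'n) \<Rightarrow> real. continuous_on UNIV f \<Longrightarrow>
      (\<lambda>n. \<integral>z. f z \<partial>\<pi> (r n)) \<longlonglongrightarrow> (\<integral>z. f z \<partial>\<pi>')"
    by (rule couplings_weakly_compact[OF \<pi>]) (rule that; assumption)
  have er: "(\<lambda>n. e (r n)) \<longlonglongrightarrow> 0" and Ar: "(\<lambda>n. A (e (r n))) \<longlonglongrightarrow> A0"
    using LIMSEQ_subseq_LIMSEQ[OF e(2) r] LIMSEQ_subseq_LIMSEQ[OF A r] by (auto simp: o_def)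
  have inner_conv: "(\<lambda>n. B \<bullet> cross_moment (\<pi> (r n))) \<longlonglongrightarrow> B \<bullet> cross_moment \<pi>'" for B
    unfolding inner_cross_moment[OF \<pi>] inner_cross_moment[OF \<pi>']
    by (intro conv continuous_intros continuous_on_outer_prod)

  have "(\<integral>z. cost A0 z \<partial>\<pi>') \<le> val A0 0"
  proof (rule field_le_epsilon)
    fix \<eta> :: real assume "\<eta> > 0"
    \<comment> \<open>The subtracted terms pay for replacing \<open>A (e (r n))\<close> by
      \<open>A0\<close> in the cost and for the slack; both vanish in the limit.\<close>
    let ?f = "\<lambda>n. (\<integral>z. cost A0 z \<partial>\<pi> (r n)) - 32 * R\<^sup>2 * norm (A (e (r n)) - A0) - e (r n)"
    have "?f \<longlonglongrightarrow> (\<integral>z. cost A0 z \<partial>\<pi>') - 32 * R\<^sup>2 * norm (A0 - A0) - 0"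
      by (intro tendsto_intros conv continuous_on_cost Ar er)
    then have "?f \<longlonglongrightarrow> (\<integral>z. cost A0 z \<partial>\<pi>')" by simp
    moreover have "\<forall>\<^sub>F n in sequentially. val (A (e (r n))) (e (r n)) < val A0 0 + \<eta>"
      using e(1) by (intro val_limsup er Ar \<open>\<eta> > 0\<close>) (simp add: less_imp_le)
    then have "\<forall>\<^sub>F n in sequentially. ?f n \<le> val A0 0 + \<eta>"
    proof eventually_elim
      case (elim n)
      have "(A (e (r n)) - A0) \<bullet> cross_moment (\<pi> (r n)) \<le> norm (A (e (r n)) - A0) * R\<^sup>2"
        using norm_cross_moment[OF \<pi>] by (intro order_trans[OF norm_cauchy_schwarz] mult_left_mono) auto
      then show ?case
        using elim cost[of "r n"] integral_cost_diff[OF \<pi>, of "r n" "A (e (r n))" A0]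
        by (simp add: mult_ac)
    qed
    ultimately show "(\<integral>z. cost A0 z \<partial>\<pi>') \<le> val A0 0 + \<eta>"
      by (intro tendsto_upperbound) auto
  qed
  with val_zero_le[OF \<pi>', of A0] have "OT_solution \<mu>0 \<mu>1 A0 0 \<pi>'"
    using \<pi>' by (simp add: OT_solution_def OT_objective_eq OT_eq_val penalty_def)
  moreover have "norm (64 *\<^sub>R A0 - 32 *\<^sub>R cross_moment \<pi>') \<le> \<delta>"
  proof -
    \<comment> \<open>Testing the bound for each \<open>n\<close> against the limit \<open>V\<close>
      itself gives the norm bound from convergence of inner products alone.\<close>
    define V where "V = 64 *\<^sub>R A0 - 32 *\<^sub>R cross_moment \<pi>'"
    have "(\<lambda>n. V \<bullet> (64 *\<^sub>R A (e (r n)) - 32 *\<^sub>R cross_moment (\<pi> (r n)))) \<longlonglongrightarrow>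
        64 * (V \<bullet> A0) - 32 * (V \<bullet> cross_moment \<pi>')"
      unfolding inner_diff_right inner_scaleR_right by (intro tendsto_intros Ar inner_conv)
    then have "(\<lambda>n. V \<bullet> (64 *\<^sub>R A (e (r n)) - 32 *\<^sub>R cross_moment (\<pi> (r n)))) \<longlonglongrightarrow> V \<bullet> V"
      by (simp add: V_def inner_diff_right)
    moreover have "(\<lambda>n. norm V * (\<delta> + e (r n))) \<longlonglongrightarrow> norm V * (\<delta> + 0)"
      by (intro tendsto_intros er)
    moreover have "V \<bullet> (64 *\<^sub>R A (e (r n)) - 32 *\<^sub>R cross_moment (\<pi> (r n))) \<le> norm V * (\<delta> + e (r n))" for n
      by (intro order_trans[OF norm_cauchy_schwarz] mult_left_mono near) auto
    ultimately have "V \<bullet> V \<le> norm V * (\<delta> + 0)"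
      by (intro LIMSEQ_le) auto
    then have "norm V * norm V \<le> norm V * \<delta>"
      by (simp add: power2_norm_eq_inner[symmetric] power2_eq_square)
    \<comment> \<open>Covers \<open>V = 0\<close>, where the factor \<open>norm V\<close> cannot be
      cancelled.\<close>
    moreover have "0 \<le> \<delta>" using grad[of 0] norm_ge_zero order_trans by blast
    ultimately have "norm V \<le> \<delta>" by (cases "norm V = 0") auto
    then show ?thesis by (simp add: V_def)
  qed
  ultimately show ?thesis by blast
qed

text \<open>Below, \<open>Phi\<close> decreases when the entropy is dropped and \<open>val\<close>
  is Lipschitz; above, \<open>val_limsup\<close> controls the competitor. A single fixed
  \<open>B\<close> suffices, so global and local minimality are both covered.\<close>

lemma limit_minimal:
  assumes e: "\<And>n. e n > 0" "e \<longlonglongrightarrow> 0" and A: "(\<lambda>n. A (e n)) \<longlonglongrightarrow> A0"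
    and min: "\<forall>\<^sub>F n in sequentially. Phi \<mu>0 \<mu>1 (e n) (A (e n)) \<le> Phi \<mu>0 \<mu>1 (e n) B"
  shows "Phi \<mu>0 \<mu>1 0 A0 \<le> Phi \<mu>0 \<mu>1 0 B"
proof (rule field_le_epsilon)
  fix \<eta> :: real assume "\<eta> > 0"
  let ?f = "\<lambda>n. 32 * (norm (A (e n)))\<^sup>2 + val A0 0 - 32 * R\<^sup>2 * norm (A0 - A (e n))"
  have "?f \<longlonglongrightarrow> 32 * (norm A0)\<^sup>2 + val A0 0 - 32 * R\<^sup>2 * norm (A0 - A0)"
    by (intro tendsto_intros A)
  then have "?f \<longlonglongrightarrow> Phi \<mu>0 \<mu>1 0 A0" by (simp add: Phi_eq)
  moreover have "\<forall>\<^sub>F n in sequentially. val B (e n) < val B 0 + \<eta>"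
    using e(1) by (intro val_limsup e(2) tendsto_const \<open>\<eta> > 0\<close>) (simp add: less_imp_le)
  with min have "\<forall>\<^sub>F n in sequentially. ?f n \<le> Phi \<mu>0 \<mu>1 0 B + \<eta>"
  proof eventually_elim
    case (elim n)
    have "val A0 0 \<le> val (A (e n)) 0 + 32 * R\<^sup>2 * norm (A0 - A (e n))"
      by (rule val_lipschitz) simp
    moreover have "val (A (e n)) 0 \<le> val (A (e n)) (e n)"
      using e(1)[of n] by (intro val_mono) simp
    ultimately show ?case using elim unfolding Phi_eq by linarith
  qed
  ultimately show "Phi \<mu>0 \<mu>1 0 A0 \<le> Phi \<mu>0 \<mu>1 0 B + \<eta>"
    by (intro tendsto_upperbound) auto
qed

end

section \<open>Reduction to bounded marginals and sequences, and the conclusion\<close>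

lemma compactly_supported_prob_bounded:
  fixes \<mu> :: "'a::euclidean_space measure"
  assumes "compactly_supported_prob \<mu>"
  obtains R where "\<And>R'. R \<le> R' \<Longrightarrow> AE x in \<mu>. norm x \<le> R'"
proof -
  have "bounded (measure_support \<mu>)"
    using assms by (auto simp: compactly_supported_prob_def intro: compact_imp_bounded)
  then obtain R where R: "\<And>x. x \<in> measure_support \<mu> \<Longrightarrow> norm x \<le> R"
    by (auto simp: bounded_iff)
  have supp: "AE x in \<mu>. x \<in> measure_support \<mu>"
    using assms by (intro AE_in_measure_support) (simp add: compactly_supported_prob_def)
  show thesis
  proof (rule that)
    show "AE x in \<mu>. norm x \<le> R'" if "R \<le> R'" for R'
      using supp by eventually_elim (use R that in force)
  qed
qed

text \<open>The same bound 1/(n+1) is imposed on the parameter and on the distance to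
  \<open>A0\<close>.\<close>

lemma cluster_point_at_right_sequence:
  fixes A :: "real \<Rightarrow> 'a::metric_space"
  assumes "cluster_point A (at_right 0) A0"
  obtains e where "\<And>n. e n > 0" "e \<longlonglongrightarrow> 0" "(\<lambda>n. A (e n)) \<longlonglongrightarrow> A0"
proof -
  have "\<exists>\<epsilon>. 0 < \<epsilon> \<and> \<epsilon> < inverse (real (Suc n)) \<and> dist (A \<epsilon>) A0 < inverse (real (Suc n))" for n
  proof -
    have "\<exists>\<^sub>F \<epsilon> in at_right 0. A \<epsilon> \<in> ball A0 (inverse (real (Suc n)))"
      using assms unfolding cluster_point_def by (metis centre_in_ball inverse_positive_iff_positive of_nat_0_less_iff open_ball zero_less_Suc)
    moreover have "\<forall>\<^sub>F \<epsilon> in at_right 0. \<epsilon> \<in> {0<..<inverse (real (Suc n))}"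
      by (rule eventually_at_right_real) simp
    ultimately have "\<exists>\<^sub>F \<epsilon> in at_right 0. A \<epsilon> \<in> ball A0 (inverse (real (Suc n))) \<and>
        \<epsilon> \<in> {0<..<inverse (real (Suc n))}"
      by (rule frequently_eventually_frequently)
    from frequently_ex[OF this] show ?thesis by (auto simp: dist_commute)
  qed
  then obtain e where e: "\<And>n. 0 < e n" "\<And>n. e n < inverse (real (Suc n))"
    "\<And>n. dist (A (e n)) A0 < inverse (real (Suc n))" by metis
  have "e \<longlonglongrightarrow> 0"
    by (rule tendsto_sandwich[OF _ _ tendsto_const LIMSEQ_inverse_real_of_nat])
       (intro always_eventually allI less_imp_le e)+
  moreover have "(\<lambda>n. dist (A (e n)) A0) \<longlonglongrightarrow> 0"
    by (rule tendsto_sandwich[OF _ _ tendsto_const LIMSEQ_inverse_real_of_nat])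
       (intro always_eventually allI zero_le_dist less_imp_le e)+
  ultimately show thesis using e(1) that tendsto_dist_iff by blast
qed

theorem theorem16:
  fixes \<mu>0 :: "(real ^ 'm) measure" and \<mu>1 :: "(real ^ 'n) measure"
    and M \<delta> :: real
    and A :: "real \<Rightarrow> real ^ 'n ^ 'm" and A0 :: "real ^ 'n ^ 'm"
  assumes "compactly_supported_prob \<mu>0" and "compactly_supported_prob \<mu>1"
    and "M > sqrt (second_moment \<mu>0 * second_moment \<mu>1)"
    and "\<delta> \<ge> 0"
    and "\<And>\<epsilon>. \<epsilon> > 0 \<Longrightarrow> norm (A \<epsilon>) \<le> M / 2"
    and "\<And>\<epsilon>. \<epsilon> > 0 \<Longrightarrow> \<exists>G. GDERIV (Phi \<mu>0 \<mu>1 \<epsilon>) (A \<epsilon>) :> G \<and> norm G \<le> \<delta>"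
    and "cluster_point A (at_right 0) A0"
  shows "(\<exists>\<pi>. OT_solution \<mu>0 \<mu>1 A0 0 \<pi> \<and>
            norm (64 *\<^sub>R A0 - 32 *\<^sub>R cross_moment \<pi>) \<le> \<delta>)
    \<and> ((\<forall>\<^sub>F \<epsilon> in at_right 0. \<forall>B. Phi \<mu>0 \<mu>1 \<epsilon> (A \<epsilon>) \<le> Phi \<mu>0 \<mu>1 \<epsilon> B)
        \<longrightarrow> (\<forall>B. Phi \<mu>0 \<mu>1 0 A0 \<le> Phi \<mu>0 \<mu>1 0 B))
    \<and> ((\<exists>(e :: nat \<Rightarrow> real) r. (\<forall>n. e n > 0) \<and> e \<longlonglongrightarrow> 0 \<and> (\<lambda>n. A (e n)) \<longlonglongrightarrow> A0 \<and> r > 0 \<and>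
            (\<forall>n. A (e n) \<in> ball A0 r \<and>
              (\<forall>B\<in>ball A0 r. Phi \<mu>0 \<mu>1 (e n) (A (e n)) \<le> Phi \<mu>0 \<mu>1 (e n) B)))
        \<longrightarrow> (\<exists>s>0. \<forall>B\<in>ball A0 s. Phi \<mu>0 \<mu>1 0 A0 \<le> Phi \<mu>0 \<mu>1 0 B))"
proof -
  obtain R0 where R0: "\<And>R'. R0 \<le> R' \<Longrightarrow> AE x in \<mu>0. norm x \<le> R'"
    using compactly_supported_prob_bounded[OF assms(1)] by metis
  obtain R1 where R1: "\<And>R'. R1 \<le> R' \<Longrightarrow> AE y in \<mu>1. norm y \<le> R'"
    using compactly_supported_prob_bounded[OF assms(2)] by metis
  \<comment> \<open>Each bound holds for every larger radius, so the maximum serves both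
    marginals.\<close>
  have "AE x in \<mu>0. norm x \<le> max R0 R1" "AE y in \<mu>1. norm y \<le> max R0 R1"
    by (simp_all add: R0 R1)
  then have "bounded_marginals \<mu>0 \<mu>1 (max R0 R1)"
    using assms(1,2) by (intro bounded_marginals.intro) (simp_all only: compactly_supported_prob_def)
  then interpret bounded_OT \<mu>0 \<mu>1 "max R0 R1"
    by (rule bounded_OT.intro)
  obtain e where e: "\<And>n. e n > 0" "e \<longlonglongrightarrow> 0" "(\<lambda>n. A (e n)) \<longlonglongrightarrow> A0"
    using cluster_point_at_right_sequence[OF assms(7)] by metis
  show ?thesis
  proof (intro conjI impI allI)
    show "\<exists>\<pi>. OT_solution \<mu>0 \<mu>1 A0 0 \<pi> \<and> norm (64 *\<^sub>R A0 - 32 *\<^sub>R cross_moment \<pi>) \<le> \<delta>"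
      by (rule limit_stationary[OF e assms(6)[OF e(1)]])
  next
    fix B
    assume "\<forall>\<^sub>F \<epsilon> in at_right 0. \<forall>B. Phi \<mu>0 \<mu>1 \<epsilon> (A \<epsilon>) \<le> Phi \<mu>0 \<mu>1 \<epsilon> B"
    then have "\<forall>\<^sub>F \<epsilon> in at_right 0. Phi \<mu>0 \<mu>1 \<epsilon> (A \<epsilon>) \<le> Phi \<mu>0 \<mu>1 \<epsilon> B"
      by eventually_elim blast
    moreover have "filterlim e (at_right 0) sequentially"
      using e(1,2) by (auto intro!: tendsto_imp_filterlim_at_right always_eventually)
    ultimately have "\<forall>\<^sub>F n in sequentially. Phi \<mu>0 \<mu>1 (e n) (A (e n)) \<le> Phi \<mu>0 \<mu>1 (e n) B"
      by (rule eventually_compose_filterlim)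
    then show "Phi \<mu>0 \<mu>1 0 A0 \<le> Phi \<mu>0 \<mu>1 0 B"
      by (rule limit_minimal[OF e])
  next
    assume "\<exists>(e :: nat \<Rightarrow> real) r. (\<forall>n. e n > 0) \<and> e \<longlonglongrightarrow> 0 \<and> (\<lambda>n. A (e n)) \<longlonglongrightarrow> A0 \<and> r > 0 \<and>
      (\<forall>n. A (e n) \<in> ball A0 r \<and>
        (\<forall>B\<in>ball A0 r. Phi \<mu>0 \<mu>1 (e n) (A (e n)) \<le> Phi \<mu>0 \<mu>1 (e n) B))"
    then obtain e' :: "nat \<Rightarrow> real" and r where e': "\<And>n. e' n > 0" "e' \<longlonglongrightarrow> 0" "(\<lambda>n. A (e' n)) \<longlonglongrightarrow> A0"
      and "r > 0"
      and min: "\<And>n B. B \<in> ball A0 r \<Longrightarrow> Phi \<mu>0 \<mu>1 (e' n) (A (e' n)) \<le> Phi \<mu>0 \<mu>1 (e' n) B"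
      by blast
    \<comment> \<open>The ball does not depend on \<open>n\<close>, so each of its points is a
      competitor along the whole sequence and the limit keeps the same radius.\<close>
    have "Phi \<mu>0 \<mu>1 0 A0 \<le> Phi \<mu>0 \<mu>1 0 B" if "B \<in> ball A0 r" for B
      using min[OF that] by (intro limit_minimal[OF e']) simp
    then show "\<exists>s>0. \<forall>B\<in>ball A0 s. Phi \<mu>0 \<mu>1 0 A0 \<le> Phi \<mu>0 \<mu>1 0 B"
      using \<open>r > 0\<close> by blast
  qed
qed

end
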